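(* Let $m\ge0$ and $n\in\mathbb Z$, let $\sigma=(\sigma_m,\dots,\sigma_1)$ be a sequence of signs $\sigma_i\in\{+,-\}$, let $\mathbf t_k=(t_{1,k},t_{2,k},\dots)$ for $0\le k\le m+1$ be independent sets of formal variables, and for $0\le k\le m$ let $\mathbf T^{(k)}=(T^{(k)}_j)_{j\in\mathbb Z}$ be parameters with diagonal group elements $O_k=\exp\left(\sum_{j\in\mathbb Z}T^{(k)}_j{:}\psi_j\psi_j^*{:}\right)$. Define the nested hypergeometric tau-function $$\tau_n^{m,\sigma}(\mathbf t_{m+1},\dots,\mathbf t_0)=\langle n|\,\gamma_+(\mathbf t_{m+1})\,O_m\,\gamma_{\sigma_m}(\mathbf t_m)\,O_{m-1}\cdots O_1\,\gamma_{\sigma_1}(\mathbf t_1)\,O_0\,\gamma_-(\mathbf t_0)\,|n\rangle .$$ Then, as formal series in the variables $\mathbf t_0,\dots,\mathbf t_{m+1}$, $$\tau_n^{m,\sigma}(\mathbf t_{m+1},\dots,\mathbf t_0)=\prod_{j=0}^m c^{(j)}_n\sum_{\lambda_0,\dots,\lambda_m}s_{\lambda_m}(\mathbf t_{m+1})\prod_{i=1}^m\left(r^{(i)}_{\lambda_i,n}\,s_{(\lambda_{i-1}/\lambda_i)^{\sigma_i}}(\mathbf t_i)\right)r^{(0)}_{\lambda_0,n}\,s_{\lambda_0}(\mathbf t_0),$$ where the sum runs over all $(m+1)$-tuples of partitions, $(\lambda/\mu)^+:=\lambda/\mu$ and $(\lambda/\mu)^-:=\mu/\lambda$.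
   Context: Free fermions $\psi_k,\psi_k^*$ ($k\in\mathbb Z$) satisfy $[\psi_n,\psi_m]_+=[\psi_n^*,\psi_m^*]_+=0$, $[\psi_n,\psi_m^*]_+=\delta_{mn}$. The vacuum $|0\rangle$ satisfies $\psi_n|0\rangle=0$ for $n<0$ and $\psi_n^*|0\rangle=0$ for $n\ge0$; the dual vacuum $\langle0|$ satisfies $\langle0|\psi_n^*=0$ for $n<0$, $\langle0|\psi_n=0$ for $n\ge0$, $\langle0|0\rangle=1$. Shifted vacua: $|n\rangle=\psi_{n-1}\cdots\psi_0|0\rangle$ ($n>0$), $|n\rangle=\psi_n^*\cdots\psi^*_{-1}|0\rangle$ ($n<0$), $\langle n|=\langle0|\psi_0^*\cdots\psi^*_{n-1}$ ($n>0$), $\langle n|=\langle0|\psi_{-1}\cdots\psi_n$ ($n<0$). Normal ordering ${:}\cdots{:}$ is with respect to $|0\rangle$ (annihilation operators to the right, with signs), e.g. ${:}\psi_k\psi_k^*{:}=\psi_k\psi_k^*-\langle0|\psi_k\psi_k^*|0\rangle$. Let $J_k=\sum_{j\in\mathbb Z}{:}\psi_j\psi^*_{j+k}{:}$ and $\gamma_\pm(\mathbf t)=\exp\left(\sum_{k>0}t_kJ_{\pm k}\right)$. For parameters $\mathbf T^{(k)}$ define $c^{(k)}_0=1$, $c^{(k)}_n=e^{T^{(k)}_0+\dots+T^{(k)}_{n-1}}$ for $n>0$, $c^{(k)}_n=e^{-T^{(k)}_{-1}-\dots-T^{(k)}_n}$ for $n<0$; let $G_k(i)=e^{T^{(k)}_i-T^{(k)}_{i-1}}$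 and $r^{(k)}_{\lambda,n}=\prod_{(i,j)\in\lambda}G_k(n+j-i)$, product over the cells $(i,j)$ (row $i$, column $j$) of the Young diagram of $\lambda$. Schur functions: define $h_k(\mathbf t)$ by $\exp(\sum_{k\ge1}t_kz^k)=\sum_{k\in\mathbb Z}h_k(\mathbf t)z^k$ (so $h_k=0$ for $k<0$); the skew Schur function is $s_{\lambda/\mu}(\mathbf t)=\det_{1\le i,j\le N}h_{\lambda_i-\mu_j-i+j}(\mathbf t)$ for any $N\ge\ell(\lambda),\ell(\mu)$ (it vanishes unless $\mu\subseteq\lambda$), and $s_\lambda=s_{\lambda/\emptyset}$. *)

theory Defs
  imports Complex_Main "HOL-Combinatorics.Permutations"
begin

text \<open>A basis state is a set S of occupied sites (S differs from {..<0} in finitely many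
  elements); the vacuum |0> is {..<0}.  A Fock vector is a coefficient function on states.
  Operators are given by their action on coefficients; the sign is (-1)^(number of occupied
  sites above n).\<close>

type_synonym fvec = "int set \<Rightarrow> complex"

definition psi :: "int \<Rightarrow> fvec \<Rightarrow> fvec" where
  "psi n v S = (if n \<in> S then (-1) ^ card {s\<in>S. s > n} * v (S - {n}) else 0)"

definition psis :: "int \<Rightarrow> fvec \<Rightarrow> fvec" where
  "psis n v S = (if n \<notin> S then (-1) ^ card {s\<in>S. s > n} * v (insert n S) else 0)"

definition vac :: fvec where
  "vac S = (if S = {..<0} then 1 else 0)"

definition bra0 :: "fvec \<Rightarrow> complex" where
  "bra0 v = v {..<0}"

fun ket_pos :: "nat \<Rightarrow> fvec" where
  "ket_pos 0 = vac"
| "ket_pos (Suc k) = psi (int k) (ket_pos k)"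

fun ket_neg :: "nat \<Rightarrow> fvec" where
  "ket_neg 0 = vac"
| "ket_neg (Suc k) = psis (- int k - 1) (ket_neg k)"

definition ket :: "int \<Rightarrow> fvec" where
  "ket n = (if 0 \<le> n then ket_pos (nat n) else ket_neg (nat (- n)))"

fun bra_pos :: "nat \<Rightarrow> fvec \<Rightarrow> complex" where
  "bra_pos 0 v = bra0 v"
| "bra_pos (Suc k) v = bra_pos k (psis (int k) v)"

fun bra_neg :: "nat \<Rightarrow> fvec \<Rightarrow> complex" where
  "bra_neg 0 v = bra0 v"
| "bra_neg (Suc k) v = bra_neg k (psi (- int k - 1) v)"

definition bra :: "int \<Rightarrow> fvec \<Rightarrow> complex" where
  "bra n v = (if 0 \<le> n then bra_pos (nat n) v else bra_neg (nat (- n)) v)"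

definition nop :: "int \<Rightarrow> int \<Rightarrow> fvec \<Rightarrow> fvec" where
  "nop j l v S = psi j (psis l v) S - bra0 (psi j (psis l vac)) * v S"

text \<open>J_k = sum_j :psi_j psi*_{j+k}: (for each state only finitely many terms are nonzero)\<close>
definition Jcur :: "int \<Rightarrow> fvec \<Rightarrow> fvec" where
  "Jcur k v S = (\<Sum>j | nop j (j + k) v S \<noteq> 0. nop j (j + k) v S)"

definition Hdiag :: "(int \<Rightarrow> complex) \<Rightarrow> fvec \<Rightarrow> fvec" where
  "Hdiag T v S = (\<Sum>j | T j * nop j j v S \<noteq> 0. T j * nop j j v S)"

definition Oop :: "(int \<Rightarrow> complex) \<Rightarrow> fvec \<Rightarrow> fvec" where
  "Oop T v S = (\<Sum>N. ((Hdiag T ^^ N) v) S / fact N)"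

type_synonym 'v mono = "'v \<Rightarrow> nat"
type_synonym 'v ser = "'v mono \<Rightarrow> complex"

definition mdeg :: "'v mono \<Rightarrow> nat" where
  "mdeg \<alpha> = sum \<alpha> {v. \<alpha> v \<noteq> 0}"

definition ser_one :: "'v ser" where
  "ser_one \<alpha> = (if (\<forall>v. \<alpha> v = 0) then 1 else 0)"

definition ser_mult :: "'v ser \<Rightarrow> 'v ser \<Rightarrow> 'v ser" where
  "ser_mult f g \<alpha> = (\<Sum>(\<beta>, \<gamma>) \<in> {(\<beta>, \<gamma>). \<forall>v. \<beta> v + \<gamma> v = \<alpha> v}. f \<beta> * g \<gamma>)"

definition ser_pow :: "'v ser \<Rightarrow> nat \<Rightarrow> 'v ser" where
  "ser_pow f N = (ser_mult f ^^ N) ser_one"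

definition ser_var :: "'v \<Rightarrow> 'v ser" where
  "ser_var x \<alpha> = (if \<alpha> = (\<lambda>v. if v = x then 1 else 0) then 1 else 0)"

text \<open>exponential of a series without constant term (terms with N > deg alpha vanish)\<close>
definition ser_exp :: "'v ser \<Rightarrow> 'v ser" where
  "ser_exp f \<alpha> = (\<Sum>N\<le>mdeg \<alpha>. ser_pow f N \<alpha> / fact N)"

definition ser_prod_list :: "'v ser list \<Rightarrow> 'v ser" where
  "ser_prod_list fs = foldr ser_mult fs ser_one"

text \<open>Variables: (i,k) stands for t_{k,i}, i.e. the k-th time of the i-th set t_i.
  Complete homogeneous h_k(t_i): coefficient of z^k (z = None) in exp(sum_{k>=1} t_{k,i} z^k).\<close>

definition hgen_arg :: "nat \<Rightarrow> ((nat \<times> nat) option) ser" where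
  "hgen_arg i \<alpha> = (\<Sum>k | 0 < k \<and> ser_mult (ser_var (Some (i, k))) (ser_pow (ser_var None) k) \<alpha> \<noteq> 0.
       ser_mult (ser_var (Some (i, k))) (ser_pow (ser_var None) k) \<alpha>)"

definition hser :: "nat \<Rightarrow> int \<Rightarrow> (nat \<times> nat) ser" where
  "hser i k \<alpha> = (if k < 0 then 0
      else ser_exp (hgen_arg i) (\<lambda>v. case v of None \<Rightarrow> nat k | Some w \<Rightarrow> \<alpha> w))"

definition is_partition :: "nat list \<Rightarrow> bool" where
  "is_partition lam = (sorted_wrt (\<ge>) lam \<and> (\<forall>x\<in>set lam. 0 < x))"

definition part :: "nat list \<Rightarrow> nat \<Rightarrow> nat" where
  "part lam i = (if 1 \<le> i \<and> i \<le> length lam then lam ! (i - 1) else 0)"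

definition cells :: "nat list \<Rightarrow> (nat \<times> nat) set" where
  "cells lam = {(i, j). 1 \<le> i \<and> i \<le> length lam \<and> 1 \<le> j \<and> j \<le> part lam i}"

text \<open>s_{lam/mu}(t_i) = det_{1<=a,b<=N} h_{lam_a - mu_b - a + b}(t_i), N = max lengths (Leibniz formula)\<close>
definition skew_schur :: "nat \<Rightarrow> nat list \<Rightarrow> nat list \<Rightarrow> (nat \<times> nat) ser" where
  "skew_schur i lam mu \<alpha> = (let N = max (length lam) (length mu) in
     (\<Sum>p | p permutes {1..N}. of_int (sign p) *
        ser_prod_list (map (\<lambda>a. hser i (int (part lam a) - int (part mu (p a)) - int a + int (p a)))
                           [1..<N+1]) \<alpha>))"

definition schur :: "nat \<Rightarrow> nat list \<Rightarrow> (nat \<times> nat) ser" where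
  "schur i lam = skew_schur i lam []"

definition cc :: "(int \<Rightarrow> complex) \<Rightarrow> int \<Rightarrow> complex" where
  "cc T n = (if n = 0 then 1
     else if 0 < n then exp (\<Sum>j\<in>{0..n-1}. T j)
     else exp (- (\<Sum>j\<in>{n..-1}. T j)))"

definition GG :: "(int \<Rightarrow> complex) \<Rightarrow> int \<Rightarrow> complex" where
  "GG T i = exp (T i - T (i - 1))"

definition rr :: "(int \<Rightarrow> complex) \<Rightarrow> nat list \<Rightarrow> int \<Rightarrow> complex" where
  "rr T lam n = (\<Prod>(i, j)\<in>cells lam. GG T (n + int j - int i))"

type_synonym svec = "(nat \<times> nat) mono \<Rightarrow> fvec"

text \<open>(sum_{k>0} t_{k,i} J_{s k}) V\<close>
definition tJ_term :: "nat \<Rightarrow> int \<Rightarrow> svec \<Rightarrow> (nat \<times> nat) mono \<Rightarrow> int set \<Rightarrow> nat \<Rightarrow> complex" where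
  "tJ_term i s V \<alpha> S k = (if 1 \<le> \<alpha> (i, k) then Jcur (s * int k) (V (\<alpha>((i, k) := \<alpha> (i, k) - 1))) S else 0)"

definition tJ :: "nat \<Rightarrow> int \<Rightarrow> svec \<Rightarrow> svec" where
  "tJ i s V \<alpha> S = (\<Sum>k | 0 < k \<and> tJ_term i s V \<alpha> S k \<noteq> 0. tJ_term i s V \<alpha> S k)"

text \<open>gamma_{+/-}(t_i) = exp(sum_{k>0} t_{k,i} J_{+/-k}); s = 1 for +, s = -1 for -\<close>
definition gam :: "nat \<Rightarrow> int \<Rightarrow> svec \<Rightarrow> svec" where
  "gam i s V \<alpha> S = (\<Sum>N\<le>mdeg \<alpha>. ((tJ i s ^^ N) V) \<alpha> S / fact N)"

definition Oser :: "(int \<Rightarrow> complex) \<Rightarrow> svec \<Rightarrow> svec" where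
  "Oser T V \<alpha> = Oop T (V \<alpha>)"

definition init :: "int \<Rightarrow> svec" where
  "init n \<alpha> = (if (\<forall>v. \<alpha> v = 0) then ket n else (\<lambda>_. 0))"

definition sgn :: "(nat \<Rightarrow> bool) \<Rightarrow> nat \<Rightarrow> int" where
  "sgn \<sigma> i = (if \<sigma> i then 1 else -1)"

fun stage :: "(nat \<Rightarrow> int \<Rightarrow> complex) \<Rightarrow> (nat \<Rightarrow> bool) \<Rightarrow> int \<Rightarrow> nat \<Rightarrow> svec" where
  "stage T \<sigma> n 0 = Oser (T 0) (gam 0 (-1) (init n))"
| "stage T \<sigma> n (Suc i) = Oser (T (Suc i)) (gam (Suc i) (sgn \<sigma> (Suc i)) (stage T \<sigma> n i))"

definition tau :: "nat \<Rightarrow> (nat \<Rightarrow> bool) \<Rightarrow> (nat \<Rightarrow> int \<Rightarrow> complex) \<Rightarrow> int \<Rightarrow> (nat \<times> nat) ser" where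
  "tau m \<sigma> T n \<alpha> = bra n (gam (m + 1) 1 (stage T \<sigma> n m) \<alpha>)"

definition sig_skew :: "(nat \<Rightarrow> bool) \<Rightarrow> nat \<Rightarrow> nat list \<Rightarrow> nat list \<Rightarrow> (nat \<times> nat) ser" where
  "sig_skew \<sigma> i lprev lcur = (if \<sigma> i then skew_schur i lprev lcur else skew_schur i lcur lprev)"

definition rhs_term :: "nat \<Rightarrow> (nat \<Rightarrow> bool) \<Rightarrow> (nat \<Rightarrow> int \<Rightarrow> complex) \<Rightarrow> int \<Rightarrow> nat list list
    \<Rightarrow> (nat \<times> nat) ser" where
  "rhs_term m \<sigma> T n ls \<alpha> = (\<Prod>i\<le>m. rr (T i) (ls ! i) n) *
     ser_prod_list ([schur (m + 1) (ls ! m)]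
                    @ map (\<lambda>i. sig_skew \<sigma> i (ls ! (i - 1)) (ls ! i)) [1..<m+1]
                    @ [schur 0 (ls ! 0)]) \<alpha>"

definition part_tuples :: "nat \<Rightarrow> nat list list set" where
  "part_tuples m = {ls. length ls = Suc m \<and> (\<forall>lam\<in>set ls. is_partition lam)}"

end

theory Submission
  imports Defs
begin

text \<open>
  A state of charge \<open>n\<close> is the set of positions \<open>x\<^sub>a = n + \<lambda>\<^sub>a - a\<close> of a partition \<open>\<lambda>\<close>. The operators
  \<open>O\<^sub>k\<close> are diagonal on states, with eigenvalue \<open>c\<^sub>n r\<^sub>\<lambda>\<^sub>,\<^sub>n\<close> by a telescoping sum over each row of \<open>\<lambda>\<close>.
  The matrix elements of \<open>\<gamma>\<^sub>\<plusminus>(t) = exp X\<close> with \<open>X = \<Sum>t\<^sub>k J\<^sub>\<plusminus>\<^sub>k\<close> are determined by the Euler operator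
  \<open>E = \<Sum>t\<^sub>k \<partial>/\<partial>t\<^sub>k\<close>: since \<open>X\<close> is linear in \<open>t\<close>, one has \<open>E \<gamma> = X \<gamma>\<close>, and this fixes \<open>\<gamma>\<close> degree by degree
  without using that the currents commute. The Jacobi-Trudi determinants satisfy the same equation:
  \<open>E h\<^sub>m = \<Sum>t\<^sub>k h\<^sub>m\<^sub>-\<^sub>k\<close>, so \<open>E\<close> shifts one row of \<open>det h(x'\<^sub>b - x\<^sub>a)\<close> at a time, which is precisely a sum of
  particle hops, the signs being absorbed by antisymmetry of the determinant. Inserting complete
  sets of states between the factors then gives the sum over tuples of partitions, which is finite
  in every degree because skew Schur functions are homogeneous.
\<close>

section \<open>Formal series\<close>

text \<open>Operators act on coefficient functions, so \<open>J_l\<close> acts by pulling back: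
  \<open>J_l v\<close> at \<open>S\<close> reads \<open>v\<close> at states where one particle of
  \<open>S\<close> has moved by \<open>+l\<close>. Hence the positions of the state being read
  (\<open>mu\<close>), not those of the input state (\<open>lam\<close>), index the rows that the
  Euler operator shifts. The obstacle is that a state is infinite while a determinant is finite.
  Only the top \<open>N\<close> particles are kept, above a filled sea, and each forbidden hop needs
  its counterpart: a hop onto another particle repeats a row, a hop down into the sea gives a zero
  row because \<open>h_k = 0\<close> for \<open>k < 0\<close>, and a hop by \<open>l > 0\<close> out
  of the sea is blocked as soon as \<open>length mu + l \<le> N\<close>. Since the determinant does
  not depend on \<open>N\<close> once \<open>N\<close> covers both lengths, \<open>N\<close> can be
  chosen this large. Monomials are arbitrary functions, so identities of series are mostly stated
  for coefficients of finite support (\<open>fin_mono\<close>). As the sets of times are disjoint, a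
  coefficient of a product of factors in different times is an ordinary product of coefficients,
  taken at the parts \<open>mono_at i\<close> of the monomial.\<close>

definition fin_mono :: "'v mono \<Rightarrow> bool" where
  "fin_mono \<alpha> \<longleftrightarrow> finite {v. \<alpha> v \<noteq> 0}"

definition wdeg :: "('v \<Rightarrow> nat) \<Rightarrow> 'v mono \<Rightarrow> nat" where
  "wdeg w \<alpha> = (\<Sum>v | \<alpha> v \<noteq> 0. w v * \<alpha> v)"

definition dec :: "'v \<Rightarrow> 'v mono \<Rightarrow> 'v mono" where
  "dec x \<alpha> = \<alpha>(x := \<alpha> x - 1)"

lemma mdeg_eq_wdeg: "mdeg \<alpha> = wdeg (\<lambda>_. 1) \<alpha>"
  by (simp add: mdeg_def wdeg_def)

lemma wdeg_superset:
  assumes "finite A" "{v. \<alpha> v \<noteq> 0} \<subseteq> A"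
  shows "wdeg w \<alpha> = (\<Sum>v\<in>A. w v * \<alpha> v)"
  unfolding wdeg_def using assms by (intro sum.mono_neutral_left) auto

lemma fin_mono_le: "fin_mono \<alpha> \<Longrightarrow> (\<And>v. \<beta> v \<le> \<alpha> v) \<Longrightarrow> fin_mono \<beta>"
  unfolding fin_mono_def by (erule rev_finite_subset) (metis (mono_tags) le_zero_eq mem_Collect_eq subsetI)

lemma fin_mono_diff: "fin_mono \<alpha> \<Longrightarrow> fin_mono (\<lambda>v. \<alpha> v - \<beta> v)"
  by (erule fin_mono_le) simp

lemma fin_mono_dec: "fin_mono \<alpha> \<Longrightarrow> fin_mono (dec x \<alpha>)"
  by (erule fin_mono_le) (simp add: dec_def)

lemma wdeg_diff:
  assumes "fin_mono \<alpha>" "\<And>v. \<beta> v \<le> \<alpha> v"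
  shows "wdeg w \<alpha> = wdeg w \<beta> + wdeg w (\<lambda>v. \<alpha> v - \<beta> v)"
proof -
  let ?A = "{v. \<alpha> v \<noteq> 0}"
  have A: "finite ?A" using assms(1) by (simp add: fin_mono_def)
  have "wdeg w \<beta> = (\<Sum>v\<in>?A. w v * \<beta> v)"
    using A by (rule wdeg_superset) (metis (mono_tags) assms(2) le_zero_eq mem_Collect_eq subsetI)
  moreover have "wdeg w (\<lambda>v. \<alpha> v - \<beta> v) = (\<Sum>v\<in>?A. w v * (\<alpha> v - \<beta> v))"
    using A by (rule wdeg_superset) auto
  moreover have "wdeg w \<alpha> = (\<Sum>v\<in>?A. w v * \<beta> v + w v * (\<alpha> v - \<beta> v))"
    unfolding wdeg_def using assms(2) by (intro sum.cong) (simp_all add: algebra_simps flip: distrib_left)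
  ultimately show ?thesis by (simp add: sum.distrib)
qed

lemma wdeg_dec:
  assumes "fin_mono \<alpha>" "\<alpha> x \<noteq> 0"
  shows "wdeg w \<alpha> = w x + wdeg w (dec x \<alpha>)"
proof -
  let ?A = "{v. \<alpha> v \<noteq> 0}"
  have A: "finite ?A" using assms(1) by (simp add: fin_mono_def)
  have "wdeg w (dec x \<alpha>) = (\<Sum>v\<in>?A. w v * dec x \<alpha> v)"
    using A by (rule wdeg_superset) (auto simp: dec_def)
  also have "\<dots> = w x * (\<alpha> x - 1) + (\<Sum>v\<in>?A - {x}. w v * \<alpha> v)"
    using A assms(2) by (simp add: sum.remove[of _ x] dec_def)
  finally have 1: "wdeg w (dec x \<alpha>) = w x * (\<alpha> x - 1) + (\<Sum>v\<in>?A - {x}. w v * \<alpha> v)" .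
  have 2: "wdeg w \<alpha> = w x * \<alpha> x + (\<Sum>v\<in>?A - {x}. w v * \<alpha> v)"
    using A assms(2) by (simp add: wdeg_def sum.remove[of _ x])
  have "w x * \<alpha> x = w x + w x * (\<alpha> x - 1)" using assms(2) by (cases "\<alpha> x") auto
  thus ?thesis using 1 2 by simp
qed

lemma mdeg_dec: "fin_mono \<alpha> \<Longrightarrow> \<alpha> x \<noteq> 0 \<Longrightarrow> mdeg \<alpha> = Suc (mdeg (dec x \<alpha>))"
  using wdeg_dec[of \<alpha> x "\<lambda>_. 1"] by (simp add: mdeg_eq_wdeg)

lemma mdeg_0_iff: "fin_mono \<alpha> \<Longrightarrow> mdeg \<alpha> = 0 \<longleftrightarrow> (\<forall>v. \<alpha> v = 0)"
  by (auto simp: mdeg_def fin_mono_def)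

lemma finite_mono_le:
  assumes "fin_mono \<alpha>" shows "finite {\<beta>. \<forall>v. \<beta> v \<le> \<alpha> v}"
proof (rule finite_subset)
  let ?A = "{v. \<alpha> v \<noteq> 0}"
  have A: "finite ?A" using assms(1) by (simp add: fin_mono_def)
  show "{\<beta>. \<forall>v. \<beta> v \<le> \<alpha> v} \<subseteq> {\<beta>. \<forall>v. (v \<in> ?A \<longrightarrow> \<beta> v \<in> {..Max (\<alpha> ` ?A)}) \<and> (v \<notin> ?A \<longrightarrow> \<beta> v = 0)}"
    using A by (auto, metis (mono_tags) Max_ge dual_order.trans finite_imageI image_eqI mem_Collect_eq, metis le_zero_eq)
  show "finite \<dots>" by (rule finite_set_of_finite_funs) (use A in auto)
qed

section \<open>The convolution product of series\<close>

lemma ser_mult_le: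
  "ser_mult f g \<alpha> = (\<Sum>\<beta> | \<forall>v. \<beta> v \<le> \<alpha> v. f \<beta> * g (\<lambda>v. \<alpha> v - \<beta> v))"
proof -
  have *: "\<gamma> = (\<lambda>v. \<alpha> v - \<beta> v)" "\<beta> v \<le> \<alpha> v" if "\<forall>v. \<beta> v + \<gamma> v = \<alpha> v" for \<beta> \<gamma> :: "'a mono" and v
    using that by (metis add_diff_cancel_left', metis le_add1)
  show ?thesis unfolding ser_mult_def
    by (rule sum.reindex_bij_witness[where j = fst and i = "\<lambda>\<beta>. (\<beta>, \<lambda>v. \<alpha> v - \<beta> v)"])
       (auto dest: *)
qed

lemma ser_mult_comm: "ser_mult f g = ser_mult g f"
proof
  fix \<alpha> show "ser_mult f g \<alpha> = ser_mult g f \<alpha>"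
    unfolding ser_mult_def
    by (rule sum.reindex_bij_witness[where j = prod.swap and i = prod.swap])
       (auto simp: add.commute)
qed

text \<open>Such a monomial has infinitely many factorizations, and a sum over an infinite set is 0
  by default. This makes the commutation laws below hold as equations between functions, with no
  finiteness assumption.\<close>

lemma ser_mult_inf:
  assumes "\<not> fin_mono \<alpha>" shows "ser_mult f g \<alpha> = 0"
proof -
  \<comment> \<open>Keeping one variable of the support at a time already gives infinitely many
    divisors.\<close>
  let ?e = "\<lambda>x v. if v = x then \<alpha> v else 0"
  have "inj_on ?e {v. \<alpha> v \<noteq> 0}"
    by (rule inj_onI) (metis (mono_tags, lifting) mem_Collect_eq)
  hence "infinite (?e ` {v. \<alpha> v \<noteq> 0})"
    using assms by (simp add: fin_mono_def finite_image_iff)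
  hence "infinite {\<beta>. \<forall>v. \<beta> v \<le> \<alpha> v}"
    by (rule contrapos_nn) (erule rev_finite_subset, auto)
  thus ?thesis by (simp add: ser_mult_le)
qed

text \<open>The form is symmetric in \<open>f\<close> and \<open>g\<close>, so left commutativity
  becomes a swap of summation variables; associativity then follows from it and
  commutativity.\<close>

lemma ser_mult_triple:
  assumes "fin_mono \<alpha>"
  shows "ser_mult f (ser_mult g h) \<alpha> =
    (\<Sum>(\<beta>, \<gamma>) | (\<forall>v. \<beta> v + \<gamma> v \<le> \<alpha> v). f \<beta> * g \<gamma> * h (\<lambda>v. \<alpha> v - (\<beta> v + \<gamma> v)))"
proof -
  have "ser_mult f (ser_mult g h) \<alpha> = (\<Sum>\<beta> | \<forall>v. \<beta> v \<le> \<alpha> v. \<Sum>\<gamma> | \<forall>v. \<gamma> v \<le> \<alpha> v - \<beta> v.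
     f \<beta> * g \<gamma> * h (\<lambda>v. \<alpha> v - (\<beta> v + \<gamma> v)))"
    by (simp add: ser_mult_le sum_distrib_left algebra_simps)
  also have "\<dots> = (\<Sum>(\<beta>, \<gamma>) \<in> Sigma {\<beta>. \<forall>v. \<beta> v \<le> \<alpha> v} (\<lambda>\<beta>. {\<gamma>. \<forall>v. \<gamma> v \<le> \<alpha> v - \<beta> v}).
     f \<beta> * g \<gamma> * h (\<lambda>v. \<alpha> v - (\<beta> v + \<gamma> v)))"
    using assms by (intro sum.Sigma ballI finite_mono_le fin_mono_diff)
  also have "Sigma {\<beta>. \<forall>v. \<beta> v \<le> \<alpha> v} (\<lambda>\<beta>. {\<gamma>. \<forall>v. \<gamma> v \<le> \<alpha> v - \<beta> v}) =
     {(\<beta>, \<gamma>). \<forall>v. \<beta> v + \<gamma> v \<le> \<alpha> v}"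
    by (auto simp: le_diff_conv2) (metis add.commute le_diff_conv2, metis add_leD1,
        metis add.commute add_le_imp_le_diff)
  finally show ?thesis .
qed

lemma ser_mult_left_comm: "ser_mult f (ser_mult g h) = ser_mult g (ser_mult f h)"
proof
  fix \<alpha> show "ser_mult f (ser_mult g h) \<alpha> = ser_mult g (ser_mult f h) \<alpha>"
  proof (cases "fin_mono \<alpha>")
    case True
    show ?thesis unfolding ser_mult_triple[OF True]
      by (rule sum.reindex_bij_witness[where j = prod.swap and i = prod.swap])
         (auto simp: add.commute)
  qed (simp add: ser_mult_inf)
qed

lemma ser_mult_assoc: "ser_mult (ser_mult f g) h = ser_mult f (ser_mult g h)"
  by (metis ser_mult_comm ser_mult_left_comm)

text \<open>Left commutativity allows any reordering of the factors; transposing a determinant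
  relies on this.\<close>

lemma ser_prod_list_mset:
  assumes "mset fs = mset gs" shows "ser_prod_list fs = ser_prod_list gs"
proof -
  have "fold ser_mult (rev fs) = fold ser_mult (rev gs)"
    using assms by (intro fold_multiset_equiv) (auto simp: fun_eq_iff ser_mult_left_comm[THEN fun_cong])
  thus ?thesis by (simp add: ser_prod_list_def foldr_conv_fold)
qed

text \<open>Multiplication by the variable \<open>x\<close>, as a shift of coefficients. It agrees
  with \<open>ser_mult (ser_var x)\<close> on monomials of finite support only, since the
  convolution product is 0 elsewhere.\<close>

definition tmul :: "'v \<Rightarrow> 'v ser \<Rightarrow> 'v ser" where
  "tmul x f \<alpha> = (if \<alpha> x \<noteq> 0 then f (dec x \<alpha>) else 0)"

lemma ser_mult_var:
  assumes "fin_mono \<alpha>" shows "ser_mult (ser_var x) f \<alpha> = tmul x f \<alpha>"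
proof -
  let ?e = "\<lambda>v. if v = x then 1 else (0::nat)"
  have "ser_mult (ser_var x) f \<alpha> = (\<Sum>\<beta> | \<forall>v. \<beta> v \<le> \<alpha> v. if \<beta> = ?e then f (\<lambda>v. \<alpha> v - ?e v) else 0)"
    unfolding ser_mult_le ser_var_def by (intro sum.cong) auto
  also have "\<dots> = (if \<forall>v. ?e v \<le> \<alpha> v then f (\<lambda>v. \<alpha> v - ?e v) else 0)"
    using finite_mono_le[OF assms] by (subst sum.delta) auto
  also have "(\<lambda>v. \<alpha> v - ?e v) = dec x \<alpha>" by (auto simp: dec_def)
  also have "(\<forall>v. ?e v \<le> \<alpha> v) \<longleftrightarrow> \<alpha> x \<noteq> 0" by auto
  finally show ?thesis by (simp add: tmul_def)
qed

lemma ser_mult_tmul: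
  assumes "fin_mono \<alpha>"
  shows "ser_mult (tmul x f) g \<alpha> = tmul x (ser_mult f g) \<alpha>"
proof -
  have "ser_mult (tmul x f) g \<alpha> = ser_mult (ser_mult (ser_var x) f) g \<alpha>"
    unfolding ser_mult_le[of "tmul x f"] ser_mult_le[of "ser_mult (ser_var x) f"]
    using assms by (intro sum.cong) (auto simp: ser_mult_var fin_mono_le)
  thus ?thesis using assms by (simp add: ser_mult_assoc ser_mult_var)
qed

lemma ser_mult_one_left: "fin_mono \<alpha> \<Longrightarrow> ser_mult ser_one f \<alpha> = f \<alpha>"
proof -
  assume "fin_mono \<alpha>"
  have "ser_mult ser_one f \<alpha> = (\<Sum>\<beta> | \<forall>v. \<beta> v \<le> \<alpha> v. if \<beta> = (\<lambda>_. 0) then f \<alpha> else 0)"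
    unfolding ser_mult_le ser_one_def by (intro sum.cong) (auto simp: fun_eq_iff)
  thus ?thesis using finite_mono_le[OF \<open>fin_mono \<alpha>\<close>] by (simp add: sum.delta)
qed

lemma ser_mult_cong:
  assumes "\<And>\<beta>. (\<And>v. \<beta> v \<le> \<alpha> v) \<Longrightarrow> f \<beta> = f' \<beta>" "\<And>\<beta>. (\<And>v. \<beta> v \<le> \<alpha> v) \<Longrightarrow> g \<beta> = g' \<beta>"
  shows "ser_mult f g \<alpha> = ser_mult f' g' \<alpha>"
  unfolding ser_mult_le by (intro sum.cong refl arg_cong2[of _ _ _ _ "(*)"] assms) auto

lemma ser_mult_sum_left:
  "ser_mult (\<lambda>\<beta>. \<Sum>k\<in>K. f k \<beta>) g \<alpha> = (\<Sum>k\<in>K. ser_mult (f k) g \<alpha>)"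
  unfolding ser_mult_le sum_distrib_right by (rule sum.swap)

section \<open>Powers of \<open>z\<close> and the complete homogeneous series\<close>

lemma ser_mult_pow_var:
  assumes "fin_mono \<alpha>"
  shows "ser_mult (ser_pow (ser_var x) k) g \<alpha> = (if k \<le> \<alpha> x then g (\<alpha>(x := \<alpha> x - k)) else 0)"
  using assms
proof (induction k arbitrary: \<alpha>)
  case 0
  thus ?case by (simp add: ser_pow_def ser_mult_one_left)
next
  case (Suc k)
  have "ser_mult (ser_pow (ser_var x) (Suc k)) g \<alpha> = tmul x (ser_mult (ser_pow (ser_var x) k) g) \<alpha>"
    using Suc.prems by (simp add: ser_pow_def ser_mult_assoc ser_mult_var)
  moreover have "(dec x \<alpha>)(x := dec x \<alpha> x - k) = \<alpha>(x := \<alpha> x - Suc k)"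
    by (simp add: dec_def)
  moreover have "k \<le> dec x \<alpha> x \<longleftrightarrow> Suc k \<le> \<alpha> x" if "\<alpha> x \<noteq> 0"
    using that by (auto simp: dec_def)
  ultimately show ?case using Suc.IH[of "dec x \<alpha>"] Suc.prems by (cases "\<alpha> x = 0") (simp_all add: tmul_def fin_mono_dec del: fun_upd_apply)
qed

text \<open>The monomial \<open>z\<^sup>k t\<^sup>\<beta>\<close>, where \<open>z\<close> is the variable \<open>None\<close>.\<close>
definition ovars :: "nat \<Rightarrow> 'v mono \<Rightarrow> 'v option mono" where
  "ovars k \<beta> = (\<lambda>v. case v of None \<Rightarrow> k | Some w \<Rightarrow> \<beta> w)"

lemma ovars_simps [simp]: "ovars k \<beta> None = k" "ovars k \<beta> (Some w) = \<beta> w"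
  by (auto simp: ovars_def)

lemma ovars_dec: "(dec (Some w) (ovars k \<beta>))(None := j) = ovars j (dec w \<beta>)"
  by (auto simp: ovars_def dec_def fun_eq_iff split: option.splits)

lemma fin_mono_ovars: "fin_mono (ovars k \<beta>) \<longleftrightarrow> fin_mono \<beta>"
proof -
  have "v \<in> {v. ovars k \<beta> v \<noteq> 0} \<longleftrightarrow> v \<in> (if k = 0 then {} else {None}) \<union> Some ` {v. \<beta> v \<noteq> 0}" for v
    by (cases v) auto
  hence "{v. ovars k \<beta> v \<noteq> 0} = (if k = 0 then {} else {None}) \<union> Some ` {v. \<beta> v \<noteq> 0}"
    by blast
  thus ?thesis by (auto simp: fin_mono_def finite_image_iff)
qed

lemma mdeg_ovars: "fin_mono \<beta> \<Longrightarrow> mdeg (ovars k \<beta>) = k + mdeg \<beta>"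
proof -
  assume f: "fin_mono \<beta>"
  have "v \<in> {v. ovars k \<beta> v \<noteq> 0} \<longleftrightarrow> v \<in> (if k = 0 then {} else {None}) \<union> Some ` {v. \<beta> v \<noteq> 0}" for v
    by (cases v) auto
  hence "{v. ovars k \<beta> v \<noteq> 0} = (if k = 0 then {} else {None}) \<union> Some ` {v. \<beta> v \<noteq> 0}"
    by blast
  thus ?thesis using f unfolding mdeg_def fin_mono_def
    by (simp only:, subst sum.union_disjoint) (auto simp: sum.reindex)
qed

text \<open>The finitely many times \<open>t_k\<close> of set \<open>i\<close> that divide the
  monomial. Sums over all \<open>k > 0\<close> with nonzero terms reduce to this set.\<close>

definition times_in :: "nat \<Rightarrow> (nat \<times> nat) mono \<Rightarrow> nat set" where
  "times_in i \<beta> = {k. 0 < k \<and> \<beta> (i, k) \<noteq> 0}"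

lemma finite_times_in: "fin_mono \<beta> \<Longrightarrow> finite (times_in i \<beta>)"
  unfolding fin_mono_def times_in_def
  by (rule finite_subset[of _ "snd ` {v. \<beta> v \<noteq> 0}"]) (force simp: image_iff)+

lemma ser_mult_hgen:
  assumes "fin_mono \<beta>"
  shows "ser_mult (hgen_arg i) g (ovars k \<beta>) =
    (\<Sum>j\<in>times_in i \<beta>. if j \<le> k then g (ovars (k - j) (dec (i, j) \<beta>)) else 0)"
proof -
  let ?t = "\<lambda>j. ser_mult (ser_var (Some (i, j))) (ser_pow (ser_var None) j)"
  have fo: "fin_mono (ovars k \<beta>)" using assms by (simp add: fin_mono_ovars)
  have "ser_mult (hgen_arg i) g (ovars k \<beta>) = ser_mult (\<lambda>\<gamma>. \<Sum>j\<in>times_in i \<beta>. ?t j \<gamma>) g (ovars k \<beta>)"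
  proof (rule ser_mult_cong)
    fix \<gamma> assume \<gamma>: "\<And>v. \<gamma> v \<le> ovars k \<beta> v"
    have "{j. 0 < j \<and> ?t j \<gamma> \<noteq> 0} \<subseteq> times_in i \<beta>"
    proof safe
      fix j assume "0 < j" "?t j \<gamma> \<noteq> 0"
      thus "j \<in> times_in i \<beta>"
        using \<gamma>[of "Some (i, j)"] fin_mono_le[OF fo \<gamma>]
        by (auto simp: times_in_def ser_mult_var tmul_def split: if_splits)
    qed
    thus "hgen_arg i \<gamma> = (\<Sum>j\<in>times_in i \<beta>. ?t j \<gamma>)"
      unfolding hgen_arg_def using finite_times_in[OF assms]
      by (intro sum.mono_neutral_left) (auto simp: times_in_def)
  qed simp
  also have "\<dots> = (\<Sum>j\<in>times_in i \<beta>. ser_mult (?t j) g (ovars k \<beta>))"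
    by (rule ser_mult_sum_left)
  also have "\<dots> = (\<Sum>j\<in>times_in i \<beta>. if j \<le> k then g (ovars (k - j) (dec (i, j) \<beta>)) else 0)"
  proof (rule sum.cong[OF refl])
    fix j assume "j \<in> times_in i \<beta>"
    have "ser_mult (?t j) g (ovars k \<beta>) = tmul (Some (i, j)) (ser_mult (ser_pow (ser_var None) j) g) (ovars k \<beta>)"
      using fo by (simp add: ser_mult_assoc ser_mult_var)
    thus "ser_mult (?t j) g (ovars k \<beta>) = (if j \<le> k then g (ovars (k - j) (dec (i, j) \<beta>)) else 0)"
      using \<open>j \<in> _\<close> fo ovars_dec[of "(i, j)" k \<beta> "k - j"]
      by (auto simp: tmul_def times_in_def ser_mult_pow_var fin_mono_dec) (simp_all add: dec_def)
  qed
  finally show ?thesis .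
qed

text \<open>The argument of the exponential is linear in the times, so its \<open>N\<close>-th power
  is homogeneous of degree \<open>N\<close> in them. Each coefficient of the exponential therefore
  comes from a single power.\<close>

lemma ser_pow_hgen_eq_0:
  assumes "fin_mono \<beta>" "mdeg \<beta> \<noteq> N"
  shows "ser_pow (hgen_arg i) N (ovars k \<beta>) = 0"
  using assms
proof (induction N arbitrary: \<beta> k)
  case 0
  thus ?case by (auto simp: ser_pow_def ser_one_def mdeg_0_iff) (metis ovars_simps(2))
next
  case (Suc N)
  have "ser_pow (hgen_arg i) N (ovars (k - j) (dec (i, j) \<beta>)) = 0" if "j \<in> times_in i \<beta>" for j
    using that Suc.prems mdeg_dec[of \<beta> "(i, j)"] by (intro Suc.IH fin_mono_dec) (auto simp: times_in_def)
  thus ?case using Suc.prems by (auto simp: ser_pow_def ser_mult_hgen intro!: sum.neutral)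
qed

lemma ser_exp_hgen:
  assumes "fin_mono \<beta>"
  shows "ser_exp (hgen_arg i) (ovars k \<beta>) = ser_pow (hgen_arg i) (mdeg \<beta>) (ovars k \<beta>) / fact (mdeg \<beta>)"
proof -
  have "ser_exp (hgen_arg i) (ovars k \<beta>) =
      (\<Sum>N\<in>{mdeg \<beta>}. ser_pow (hgen_arg i) N (ovars k \<beta>) / fact N)"
    unfolding ser_exp_def using assms
    by (intro sum.mono_neutral_right) (auto simp: mdeg_ovars intro: ser_pow_hgen_eq_0)
  thus ?thesis by simp
qed

lemma hser_zero_mono: "hser i k (\<lambda>_. 0) = (if k = 0 then 1 else 0)"
proof -
  have "fin_mono (\<lambda>_ :: nat \<times> nat. 0)" "mdeg (\<lambda>_ :: nat \<times> nat. 0) = 0" by (auto simp: fin_mono_def mdeg_def)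
  moreover have "(\<forall>v. ovars (nat k) (\<lambda>_ :: nat \<times> nat. 0) v = 0) \<longleftrightarrow> k \<le> 0"
    by (metis nat_le_0 nat_0_iff not_None_eq ovars_simps)
  ultimately have "ser_exp (hgen_arg i) (ovars (nat k) (\<lambda>_. 0)) = (if k \<le> 0 then 1 else 0)"
    by (simp add: ser_exp_hgen ser_pow_def ser_one_def)
  moreover have "hser i k (\<lambda>_. 0) = (if k < 0 then 0 else ser_exp (hgen_arg i) (ovars (nat k) (\<lambda>_. 0)))"
    by (simp only: hser_def ovars_def)
  ultimately show ?thesis by auto
qed

lemma hser_neg: "k < 0 \<Longrightarrow> hser i k \<beta> = 0"
  by (simp add: hser_def)

text \<open>Multiplying the coefficient of each monomial by its degree is the Euler operator, which acts
  on \<open>exp (\<Sum>j. t\<^sub>j z\<^sup>j)\<close> as multiplication by \<open>\<Sum>j. t\<^sub>j z\<^sup>j\<close>.\<close>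
lemma hser_euler:
  assumes "fin_mono \<beta>"
  shows "of_nat (mdeg \<beta>) * hser i k \<beta> = (\<Sum>j\<in>times_in i \<beta>. hser i (k - int j) (dec (i, j) \<beta>))"
proof (cases "k < 0")
  case False
  have h: "hser i k \<gamma> = (if k < 0 then 0 else ser_exp (hgen_arg i) (ovars (nat k) \<gamma>))" for k \<gamma>
    by (simp add: hser_def ovars_def)
  show ?thesis
  proof (cases "mdeg \<beta>")
    case 0
    thus ?thesis using assms by (simp add: mdeg_0_iff times_in_def)
  next
    case (Suc d)
    have "of_nat (mdeg \<beta>) * hser i k \<beta> = ser_pow (hgen_arg i) (Suc d) (ovars (nat k) \<beta>) / fact d"
      using False Suc assms by (simp add: h ser_exp_hgen del: of_nat_Suc)
    also have "\<dots> = (\<Sum>j\<in>times_in i \<beta>. (if j \<le> nat k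
        then ser_pow (hgen_arg i) d (ovars (nat k - j) (dec (i, j) \<beta>)) else 0) / fact d)"
      using assms by (simp add: ser_pow_def ser_mult_hgen sum_divide_distrib cong: if_cong)
    also have "\<dots> = (\<Sum>j\<in>times_in i \<beta>. hser i (k - int j) (dec (i, j) \<beta>))"
    proof (rule sum.cong[OF refl])
      fix j assume "j \<in> times_in i \<beta>"
      hence "mdeg (dec (i, j) \<beta>) = d" using Suc assms mdeg_dec[of \<beta> "(i, j)"] by (auto simp: times_in_def)
      thus "(if j \<le> nat k then ser_pow (hgen_arg i) d (ovars (nat k - j) (dec (i, j) \<beta>)) else 0) / fact d
         = hser i (k - int j) (dec (i, j) \<beta>)"
        using False assms by (auto simp: h ser_exp_hgen fin_mono_dec nat_diff_distrib)
    qed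
    finally show ?thesis .
  qed
qed (simp add: hser_neg)

text \<open>In positive degree the Euler identity expresses \<open>h_0\<close> through
  \<open>h_(-j)\<close> with \<open>j > 0\<close>, and these vanish.\<close>

lemma hser_zero: "fin_mono \<beta> \<Longrightarrow> hser i 0 \<beta> = ser_one \<beta>"
proof (cases "mdeg \<beta> = 0")
  case True
  assume "fin_mono \<beta>"
  with True have "\<beta> = (\<lambda>_. 0)" by (auto simp: mdeg_0_iff)
  thus ?thesis by (simp add: hser_zero_mono ser_one_def)
next
  case False
  assume f: "fin_mono \<beta>"
  have "of_nat (mdeg \<beta>) * hser i 0 \<beta> = 0"
    unfolding hser_euler[OF f] by (intro sum.neutral) (auto simp: hser_neg times_in_def)
  with False f show ?thesis by (auto simp: ser_one_def mdeg_0_iff)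
qed

text \<open>With weight \<open>k\<close> on \<open>t_k\<close> (hence \<open>snd\<close>),
  \<open>h_k\<close> is homogeneous of weight \<open>k\<close>: each use of the Euler identity
  removes one \<open>t_j\<close> and lowers the index by \<open>j\<close>.\<close>

lemma hser_nonzeroD:
  assumes "fin_mono \<beta>" "hser i k \<beta> \<noteq> 0"
  shows "k = int (wdeg snd \<beta>) \<and> (\<forall>v. \<beta> v \<noteq> 0 \<longrightarrow> fst v = i)"
  using assms
proof (induction "mdeg \<beta>" arbitrary: \<beta> k)
  case 0
  hence "\<beta> = (\<lambda>_. 0)" by (auto simp: mdeg_0_iff)
  thus ?case using 0 by (auto simp: hser_zero_mono wdeg_def split: if_splits)
next
  case (Suc d)
  have "(\<Sum>j\<in>times_in i \<beta>. hser i (k - int j) (dec (i, j) \<beta>)) \<noteq> 0"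
    unfolding hser_euler[OF Suc.prems(1), symmetric] using Suc by (metis mult_eq_0_iff of_nat_eq_0_iff nat.distinct(1))
  then obtain j where j: "j \<in> times_in i \<beta>" "hser i (k - int j) (dec (i, j) \<beta>) \<noteq> 0"
    by (meson sum.not_neutral_contains_not_neutral)
  have jn: "\<beta> (i, j) \<noteq> 0" using j by (simp add: times_in_def)
  have "k - int j = int (wdeg snd (dec (i, j) \<beta>)) \<and> (\<forall>v. dec (i, j) \<beta> v \<noteq> 0 \<longrightarrow> fst v = i)"
    using j jn Suc mdeg_dec[of \<beta> "(i, j)"] by (intro Suc.hyps(1) fin_mono_dec) auto
  moreover have "wdeg snd \<beta> = j + wdeg snd (dec (i, j) \<beta>)"
    using wdeg_dec[OF Suc.prems(1) jn, of snd] by simp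
  moreover have "dec (i, j) \<beta> v = \<beta> v" if "v \<noteq> (i, j)" for v
    using that by (simp add: dec_def)
  ultimately show ?case by (metis diff_add_cancel add.commute fst_conv of_nat_add)
qed

section \<open>Determinants of series\<close>

lemma ser_prod_list_Nil: "ser_prod_list [] = ser_one"
  and ser_prod_list_Cons: "ser_prod_list (f # fs) = ser_mult f (ser_prod_list fs)"
  by (simp_all add: ser_prod_list_def)

lemma ser_prod_list_zero:
  assumes "f \<in> set fs" "\<And>\<beta>. f \<beta> = 0"
  shows "ser_prod_list fs \<alpha> = 0"
  using assms(1)
proof (induction fs arbitrary: \<alpha>)
  case (Cons g fs)
  thus ?case using assms(2) by (auto simp: ser_prod_list_Cons ser_mult_le intro!: sum.neutral)
qed simp

lemma ser_prod_list_snoc_one: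
  assumes "fin_mono \<alpha>" "\<And>\<beta>. fin_mono \<beta> \<Longrightarrow> f \<beta> = ser_one \<beta>"
  shows "ser_prod_list (fs @ [f]) \<alpha> = ser_prod_list fs \<alpha>"
  using assms(1)
proof (induction fs arbitrary: \<alpha>)
  case Nil
  have "ser_prod_list ([] @ [f]) \<alpha> = ser_mult ser_one ser_one \<alpha>"
    unfolding append_Nil ser_prod_list_Cons ser_prod_list_Nil
    by (rule ser_mult_cong) (use Nil assms(2) fin_mono_le in blast)+
  thus ?case using Nil by (simp add: ser_prod_list_Nil ser_mult_one_left)
next
  case (Cons g fs)
  show ?case unfolding append_Cons ser_prod_list_Cons
    by (rule ser_mult_cong) (use Cons fin_mono_le in blast)+
qed

text \<open>The product rule for the Euler operator. \<open>K\<close> is a fixed superset of the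
  times because the factors are evaluated at divisors of \<open>\<alpha>\<close>, each with its own
  \<open>times_in\<close>.\<close>

lemma ser_prod_list_euler:
  assumes "distinct as" "finite K" "fin_mono \<alpha>" "times_in i \<alpha> \<subseteq> K"
    and f: "\<And>a \<gamma>. a \<in> set as \<Longrightarrow> fin_mono \<gamma> \<Longrightarrow> times_in i \<gamma> \<subseteq> K \<Longrightarrow>
      of_nat (mdeg \<gamma>) * f a \<gamma> = (\<Sum>k\<in>K. tmul (i, k) (f' k a) \<gamma>)"
  shows "of_nat (mdeg \<alpha>) * ser_prod_list (map f as) \<alpha> =
    (\<Sum>a\<in>set as. \<Sum>k\<in>K. tmul (i, k) (ser_prod_list (map (\<lambda>c. if c = a then f' k c else f c) as)) \<alpha>)"
  using assms(1,3,4) f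
proof (induction as arbitrary: \<alpha>)
  case Nil
  thus ?case by (auto simp: ser_prod_list_Nil ser_one_def mdeg_0_iff)
next
  case (Cons b as)
  let ?P = "ser_prod_list (map f as)"
  let ?Q = "\<lambda>a k. ser_prod_list (map (\<lambda>c. if c = a then f' k c else f c) as)"
  have sub: "fin_mono \<beta> \<and> times_in i \<beta> \<subseteq> K" if "\<And>v. \<beta> v \<le> \<alpha> v" for \<beta>
  proof
    show "fin_mono \<beta>" using Cons.prems(2) that by (rule fin_mono_le)
    have "times_in i \<beta> \<subseteq> times_in i \<alpha>"
      unfolding times_in_def using that by (metis (mono_tags, lifting) Collect_mono le_zero_eq)
    thus "times_in i \<beta> \<subseteq> K" using Cons.prems(3) by blast
  qed
  \<comment> \<open>Degrees add up over a factorization of the monomial, so the Euler operator is a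
    derivation.\<close>
  have E: "of_nat (mdeg \<alpha>) * ser_mult g h \<alpha> =
     ser_mult (\<lambda>\<beta>. of_nat (mdeg \<beta>) * g \<beta>) h \<alpha> + ser_mult (\<lambda>\<beta>. of_nat (mdeg \<beta>) * h \<beta>) g \<alpha>" for g h
    unfolding ser_mult_comm[of _ g] unfolding ser_mult_le sum_distrib_left sum.distrib[symmetric]
  proof (rule sum.cong[OF refl])
    fix \<beta> assume "\<beta> \<in> {\<beta>. \<forall>v. \<beta> v \<le> \<alpha> v}"
    hence "mdeg \<alpha> = mdeg \<beta> + mdeg (\<lambda>v. \<alpha> v - \<beta> v)"
      unfolding mdeg_eq_wdeg by (intro wdeg_diff Cons.prems(2)) blast
    thus "of_nat (mdeg \<alpha>) * (g \<beta> * h (\<lambda>v. \<alpha> v - \<beta> v)) =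
      of_nat (mdeg \<beta>) * g \<beta> * h (\<lambda>v. \<alpha> v - \<beta> v) +
      g \<beta> * (of_nat (mdeg (\<lambda>v. \<alpha> v - \<beta> v)) * h (\<lambda>v. \<alpha> v - \<beta> v))"
      by (simp add: algebra_simps)
  qed
  have A: "ser_mult (\<lambda>\<beta>. of_nat (mdeg \<beta>) * f b \<beta>) ?P \<alpha> =
      (\<Sum>k\<in>K. tmul (i, k) (ser_mult (f' k b) ?P) \<alpha>)"
  proof -
    have "ser_mult (\<lambda>\<beta>. of_nat (mdeg \<beta>) * f b \<beta>) ?P \<alpha> = ser_mult (\<lambda>\<beta>. \<Sum>k\<in>K. tmul (i, k) (f' k b) \<beta>) ?P \<alpha>"
      by (rule ser_mult_cong) (use sub Cons.prems in auto)
    thus ?thesis using Cons.prems(2) by (simp add: ser_mult_sum_left ser_mult_tmul)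
  qed
  have B: "ser_mult (\<lambda>\<beta>. of_nat (mdeg \<beta>) * ?P \<beta>) (f b) \<alpha> =
      (\<Sum>a\<in>set as. \<Sum>k\<in>K. tmul (i, k) (ser_mult (f b) (?Q a k)) \<alpha>)"
  proof -
    have "ser_mult (\<lambda>\<beta>. of_nat (mdeg \<beta>) * ?P \<beta>) (f b) \<alpha> =
       ser_mult (\<lambda>\<beta>. \<Sum>a\<in>set as. \<Sum>k\<in>K. tmul (i, k) (?Q a k) \<beta>) (f b) \<alpha>"
      by (rule ser_mult_cong) (use sub Cons in auto)
    thus ?thesis using Cons.prems(2) by (simp add: ser_mult_sum_left ser_mult_tmul ser_mult_comm[of "f b"])
  qed
  have b: "b \<notin> set as" using Cons.prems(1) by simp
  let ?R = "\<lambda>a. \<Sum>k\<in>K. tmul (i, k) (ser_prod_list (map (\<lambda>c. if c = a then f' k c else f c) (b # as))) \<alpha>"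
  have "map (\<lambda>c. if c = b then f' k c else f c) as = map f as" for k
    using b by (intro map_cong) auto
  hence 1: "?R b = (\<Sum>k\<in>K. tmul (i, k) (ser_mult (f' k b) ?P) \<alpha>)"
    by (simp only: ser_prod_list_Cons list.map if_True refl)
  have 2: "(\<Sum>a\<in>set as. ?R a) = (\<Sum>a\<in>set as. \<Sum>k\<in>K. tmul (i, k) (ser_mult (f b) (?Q a k)) \<alpha>)"
  proof (rule sum.cong[OF refl])
    fix a assume "a \<in> set as"
    with b have "b \<noteq> a" by blast
    thus "?R a = (\<Sum>k\<in>K. tmul (i, k) (ser_mult (f b) (?Q a k)) \<alpha>)"
      by (simp add: ser_prod_list_Cons)
  qed
  have "of_nat (mdeg \<alpha>) * ser_prod_list (map f (b # as)) \<alpha> = of_nat (mdeg \<alpha>) * ser_mult (f b) ?P \<alpha>"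
    by (simp only: list.map ser_prod_list_Cons)
  also have "\<dots> = ?R b + (\<Sum>a\<in>set as. ?R a)"
    by (simp only: E A B 1 2)
  also have "\<dots> = (\<Sum>a\<in>set (b # as). ?R a)"
    using b by (simp only: list.set sum.insert finite_set not_False_eq_True)
  finally show ?case .
qed

text \<open>Kept in Leibniz form: series as plain functions are not a ring with unit, since
  \<open>ser_one\<close> is neutral only at monomials of finite support.\<close>

definition sdet :: "nat \<Rightarrow> (nat \<Rightarrow> nat \<Rightarrow> 'v ser) \<Rightarrow> 'v ser" where
  "sdet N g \<alpha> = (\<Sum>p | p permutes {1..N}. of_int (sign p) * ser_prod_list (map (\<lambda>a. g a (p a)) [1..<N+1]) \<alpha>)"

lemma sdet_cong:
  assumes "\<And>a b. a \<in> {1..N} \<Longrightarrow> b \<in> {1..N} \<Longrightarrow> g a b = g' a b"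
  shows "sdet N g = sdet N g'"
proof
  fix \<alpha>
  have "map (\<lambda>a. g a (p a)) [1..<N+1] = map (\<lambda>a. g' a (p a)) [1..<N+1]" if "p permutes {1..N}" for p
    using assms permutes_in_image[OF that] by (intro map_cong refl) auto
  thus "sdet N g \<alpha> = sdet N g' \<alpha>" unfolding sdet_def
    by (intro sum.cong refl arg_cong2[of _ _ _ _ "(*)"] arg_cong[where f = "\<lambda>x. ser_prod_list x \<alpha>"]) simp
qed

lemma mset_upt_permute:
  assumes "p permutes {1..N}"
  shows "mset (map p [1..<N+1]) = mset [1..<N+1]"
proof -
  have "mset (map p [1..<N+1]) = image_mset p (mset_set {1..N})"
    by (metis Suc_eq_plus1 atLeastLessThanSuc_atLeastAtMost mset_map mset_upt)
  also have "\<dots> = mset_set {1..N}"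
    using assms by (metis image_mset_mset_set permutes_image permutes_inj_on)
  also have "\<dots> = mset [1..<N+1]"
    by (metis Suc_eq_plus1 atLeastLessThanSuc_atLeastAtMost mset_upt)
  finally show ?thesis .
qed

text \<open>Substitute the inverse permutation, then reorder the factors of each term along
  \<open>p\<close>.\<close>

lemma sdet_transpose: "sdet N (\<lambda>a b. g b a) = sdet N g"
proof
  fix \<alpha>
  have "sdet N (\<lambda>a b. g b a) \<alpha> = (\<Sum>p | p permutes {1..N}. of_int (sign (inv p)) *
      ser_prod_list (map (\<lambda>a. g (inv p a) a) [1..<N+1]) \<alpha>)"
    unfolding sdet_def by (rule sum_permutations_inverse)
  also have "\<dots> = sdet N g \<alpha>"
    unfolding sdet_def
  proof (rule sum.cong[OF refl])
    fix p assume "p \<in> {p. p permutes {1..N}}"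
    hence p: "p permutes {1..N}" by simp
    have "sign (inv p) = sign p"
      using p by (metis finite_atLeastAtMost permutation_permutes sign_inverse)
    have "mset (map (\<lambda>a. g (inv p a) a) [1..<N+1]) = image_mset (\<lambda>a. g (inv p a) a) (mset (map p [1..<N+1]))"
      unfolding mset_upt_permute[OF p] by (rule mset_map)
    also have "\<dots> = mset (map (\<lambda>a. g a (p a)) [1..<N+1])"
      using permutes_inverses(2)[OF p] by (simp add: multiset.map_comp comp_def)
    finally have "ser_prod_list (map (\<lambda>a. g (inv p a) a) [1..<N+1]) = ser_prod_list (map (\<lambda>a. g a (p a)) [1..<N+1])"
      by (rule ser_prod_list_mset)
    thus "of_int (sign (inv p)) * ser_prod_list (map (\<lambda>a. g (inv p a) a) [1..<N+1]) \<alpha> =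
        of_int (sign p) * ser_prod_list (map (\<lambda>a. g a (p a)) [1..<N+1]) \<alpha>"
      using \<open>sign (inv p) = sign p\<close> by simp
  qed
  finally show "sdet N (\<lambda>a b. g b a) \<alpha> = sdet N g \<alpha>" .
qed

text \<open>After transposing, the permutation sits in the row argument, where the swap is absorbed
  by substituting \<open>?t \<circ> p\<close> for \<open>p\<close>; only the sign of
  \<open>?t\<close> remains.\<close>

lemma sdet_swap_rows:
  assumes "b \<in> {1..N}" "c \<in> {1..N}" "b \<noteq> c"
  shows "sdet N (\<lambda>a. g (transpose b c a)) \<alpha> = - sdet N g \<alpha>"
proof -
  let ?t = "transpose b c"
  have t: "?t permutes {1..N}" using assms by (intro permutes_swap_id)
  have "sdet N (\<lambda>a. g (?t a)) \<alpha> = sdet N (\<lambda>a b. g (?t b) a) \<alpha>"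
    by (subst sdet_transpose) simp
  also have "\<dots> = (\<Sum>p | p permutes {1..N}. of_int (sign (?t \<circ> p)) *
     ser_prod_list (map (\<lambda>a. g (?t ((?t \<circ> p) a)) a) [1..<N+1]) \<alpha>)"
    unfolding sdet_def using t by (rule setum_permutations_compose_left)
  also have "\<dots> = (\<Sum>p | p permutes {1..N}. - (of_int (sign p) *
     ser_prod_list (map (\<lambda>a. g (p a) a) [1..<N+1]) \<alpha>))"
  proof (rule sum.cong[OF refl])
    fix p assume "p \<in> {p. p permutes {1..N}}"
    hence "permutation p" by (auto intro: permutation_permutes[THEN iffD2])
    hence "sign (?t \<circ> p) = - sign p"
      using assms(3) by (subst sign_compose) (auto simp: permutation_swap_id sign_swap_id)
    thus "of_int (sign (?t \<circ> p)) * ser_prod_list (map (\<lambda>a. g (?t ((?t \<circ> p) a)) a) [1..<N+1]) \<alpha> =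
      - (of_int (sign p) * ser_prod_list (map (\<lambda>a. g (p a) a) [1..<N+1]) \<alpha>)"
      by (simp add: comp_def del: upt_Suc)
  qed
  also have "\<dots> = - sdet N (\<lambda>a b. g b a) \<alpha>" by (simp add: sdet_def sum_negf)
  also have "sdet N (\<lambda>a b. g b a) = sdet N g" by (rule sdet_transpose)
  finally show ?thesis .
qed

lemma sdet_zero_row:
  assumes "a \<in> {1..N}" "\<And>b \<beta>. b \<in> {1..N} \<Longrightarrow> g a b \<beta> = 0"
  shows "sdet N g \<alpha> = 0"
  unfolding sdet_def
proof (intro sum.neutral ballI)
  fix p assume "p \<in> {p. p permutes {1..N}}"
  hence "p a \<in> {1..N}" using assms(1) permutes_in_image[of p "{1..N}" a] by simp
  hence "ser_prod_list (map (\<lambda>a. g a (p a)) [1..<N+1]) \<alpha> = 0"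
    using assms by (intro ser_prod_list_zero[of "g a (p a)"]) (auto simp del: upt_Suc)
  thus "of_int (sign p) * ser_prod_list (map (\<lambda>a. g a (p a)) [1..<N+1]) \<alpha> = 0" by simp
qed

text \<open>A permutation that moves \<open>Suc N\<close> picks a zero from the last row. This is
  what makes the Jacobi-Trudi determinant independent of its size.\<close>

lemma sdet_Suc:
  assumes "fin_mono \<alpha>"
    and "\<And>b \<beta>. b \<in> {1..N} \<Longrightarrow> g (Suc N) b \<beta> = 0"
    and "\<And>\<beta>. fin_mono \<beta> \<Longrightarrow> g (Suc N) (Suc N) \<beta> = ser_one \<beta>"
  shows "sdet (Suc N) g \<alpha> = sdet N g \<alpha>"
proof -
  let ?t = "\<lambda>p N. of_int (sign p) * ser_prod_list (map (\<lambda>a. g a (p a)) [1..<N+1]) \<alpha>"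
  have "sdet (Suc N) g \<alpha> = (\<Sum>p | p permutes {1..N}. ?t p (Suc N))"
    unfolding sdet_def
  proof (rule sum.mono_neutral_right)
    show "{p. p permutes {1..N}} \<subseteq> {p. p permutes {1..Suc N}}"
      by (auto intro: permutes_subset)
    show "\<forall>p\<in>{p. p permutes {1..Suc N}} - {p. p permutes {1..N}}. ?t p (Suc N) = 0"
    proof
      fix p assume p: "p \<in> {p. p permutes {1..Suc N}} - {p. p permutes {1..N}}"
      have "p (Suc N) \<noteq> Suc N"
      proof
        assume "p (Suc N) = Suc N"
        hence "p permutes {1..N}"
          using p by (elim DiffE CollectE, elim permutes_superset) (auto simp: le_Suc_eq)
        thus False using p by simp
      qed
      moreover have "p (Suc N) \<in> {1..Suc N}" using p permutes_in_image[of p "{1..Suc N}" "Suc N"] by simp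
      ultimately have "ser_prod_list (map (\<lambda>a. g a (p a)) [1..<Suc N+1]) \<alpha> = 0"
        using assms(2) by (intro ser_prod_list_zero[of "g (Suc N) (p (Suc N))"]) auto
      thus "?t p (Suc N) = 0" by simp
    qed
  qed (simp add: finite_permutations)
  also have "\<dots> = sdet N g \<alpha>"
    unfolding sdet_def
  proof (rule sum.cong[OF refl])
    fix p assume "p \<in> {p. p permutes {1..N}}"
    hence "p (Suc N) = Suc N" by (intro permutes_not_in[of p "{1..N}"]) simp_all
    moreover have "[1..<Suc N + 1] = [1..<N + 1] @ [Suc N]" by simp
    ultimately show "?t p (Suc N) = ?t p N"
      using ser_prod_list_snoc_one[OF assms(1,3)] by (simp only: map_append list.map)
  qed
  finally show ?thesis .
qed

text \<open>The product rule in every Leibniz term; collecting the terms by the factor that was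
  differentiated replaces one row at a time.\<close>

lemma sdet_euler:
  assumes "fin_mono \<alpha>" "finite K" "times_in i \<alpha> \<subseteq> K"
    and g: "\<And>a b \<gamma>. a \<in> {1..N} \<Longrightarrow> b \<in> {1..N} \<Longrightarrow> fin_mono \<gamma> \<Longrightarrow> times_in i \<gamma> \<subseteq> K \<Longrightarrow>
      of_nat (mdeg \<gamma>) * g a b \<gamma> = (\<Sum>k\<in>K. tmul (i, k) (g' k a b) \<gamma>)"
  shows "of_nat (mdeg \<alpha>) * sdet N g \<alpha> =
    (\<Sum>a=1..N. \<Sum>k\<in>K. tmul (i, k) (sdet N (\<lambda>c. if c = a then g' k c else g c)) \<alpha>)"
proof -
  let ?m = "\<lambda>p k a. map (\<lambda>c. if c = a then g' k c (p c) else g c (p c)) [1..<N+1]"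
  have "of_nat (mdeg \<alpha>) * sdet N g \<alpha> = (\<Sum>p | p permutes {1..N}. of_int (sign p) *
     (of_nat (mdeg \<alpha>) * ser_prod_list (map (\<lambda>a. g a (p a)) [1..<N+1]) \<alpha>))"
    by (simp add: sdet_def sum_distrib_left algebra_simps)
  also have "\<dots> = (\<Sum>p | p permutes {1..N}. of_int (sign p) *
     (\<Sum>a=1..N. \<Sum>k\<in>K. tmul (i, k) (ser_prod_list (?m p k a)) \<alpha>))"
  proof (intro sum.cong refl arg_cong2[of _ _ _ _ "(*)"])
    fix p assume "p \<in> {p. p permutes {1..N}}"
    hence "p a \<in> {1..N}" if "a \<in> {1..N}" for a
      using that permutes_in_image[of p "{1..N}" a] by simp
    hence "of_nat (mdeg \<alpha>) * ser_prod_list (map (\<lambda>a. g a (p a)) [1..<N+1]) \<alpha> =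
      (\<Sum>a\<in>set [1..<N+1]. \<Sum>k\<in>K. tmul (i, k) (ser_prod_list (?m p k a)) \<alpha>)"
      using assms by (intro ser_prod_list_euler[where f' = "\<lambda>k c. g' k c (p c)"]) (auto intro!: g)
    moreover have "set [1..<N+1] = {1..N}" by auto
    ultimately show "of_nat (mdeg \<alpha>) * ser_prod_list (map (\<lambda>a. g a (p a)) [1..<N+1]) \<alpha> =
      (\<Sum>a=1..N. \<Sum>k\<in>K. tmul (i, k) (ser_prod_list (?m p k a)) \<alpha>)" by simp
  qed
  also have "\<dots> = (\<Sum>a=1..N. \<Sum>k\<in>K. \<Sum>p | p permutes {1..N}. of_int (sign p) * tmul (i, k) (ser_prod_list (?m p k a)) \<alpha>)"
  proof -
    have "(\<Sum>p | p permutes {1..N}. of_int (sign p) * (\<Sum>a=1..N. \<Sum>k\<in>K. X p k a)) =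
      (\<Sum>a=1..N. \<Sum>k\<in>K. \<Sum>p | p permutes {1..N}. of_int (sign p) * X p k a)" for X :: "_ \<Rightarrow> _ \<Rightarrow> _ \<Rightarrow> complex"
      unfolding sum_distrib_left by (rule trans[OF sum.swap], intro sum.cong refl, rule sum.swap)
    thus ?thesis .
  qed
  also have "\<dots> = (\<Sum>a=1..N. \<Sum>k\<in>K. tmul (i, k) (sdet N (\<lambda>c. if c = a then g' k c else g c)) \<alpha>)"
    by (intro sum.cong refl) (simp add: tmul_def sdet_def if_distribR del: upt_Suc)
  finally show ?thesis .
qed

section \<open>Currents acting on states\<close>

text \<open>Adjacent swaps generate all permutations, and in this form the sign of a move is found
  by counting the entries passed.\<close>

definition alternating :: "nat \<Rightarrow> ('a list \<Rightarrow> complex) \<Rightarrow> bool" where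
  "alternating N F \<longleftrightarrow>
    (\<forall>us a b vs. length (us @ a # b # vs) = N \<longrightarrow> F (us @ a # b # vs) = - F (us @ b # a # vs))"

lemma alternating_move:
  assumes "alternating N F" "length (ps @ us @ z # vs) = N"
  shows "F (ps @ us @ z # vs) = (-1) ^ length us * F (ps @ z # us @ vs)"
  using assms(2)
proof (induction us arbitrary: vs rule: rev_induct)
  case (snoc a us)
  have "F (ps @ (us @ [a]) @ z # vs) = - F (ps @ us @ z # a # vs)"
    using assms(1) snoc.prems unfolding alternating_def
    by (metis append.assoc append_Cons append_Nil)
  thus ?case using snoc by simp
qed simp

lemma alternating_dup:
  assumes "alternating N F" "length (ps @ z # us @ z # vs) = N"
  shows "F (ps @ z # us @ z # vs) = 0"
proof -
  have "F (ps @ z # z # us @ vs) = - F (ps @ z # z # us @ vs)"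
    using assms(2) by (intro assms(1)[unfolded alternating_def, rule_format]) simp
  hence "F (ps @ z # z # us @ vs) = 0" by simp
  thus ?thesis using alternating_move[OF assms(1), of "ps @ [z]" us z vs] assms(2) by simp
qed

lemma alternating_not_distinct:
  assumes "alternating N F" "length (us @ z # vs) = N" "z \<in> set us \<union> set vs"
  shows "F (us @ z # vs) = 0"
proof -
  consider "z \<in> set us" | "z \<in> set vs" using assms(3) by blast
  thus ?thesis
  proof cases
    case 1
    then obtain as bs where "us = as @ z # bs" by (meson split_list)
    thus ?thesis using alternating_dup[OF assms(1), of as z bs vs] assms(2) by simp
  next
    case 2
    then obtain as bs where "vs = as @ z # bs" by (meson split_list)
    thus ?thesis using alternating_dup[OF assms(1), of us z as bs] assms(2) by simp
  qed
qed

text \<open>The vacuum expectation is 0 for distinct indices, so normal ordering has no effect. The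
  value of \<open>v\<close> is taken at the state in which the particle at \<open>j\<close> sits at
  \<open>k\<close>.\<close>

lemma nop_offdiag:
  assumes "j \<noteq> k"
  shows "nop j k v S = (if j \<in> S \<and> k \<notin> S
    then (-1) ^ card {s\<in>S. s > j} * (-1) ^ card {s\<in>S - {j}. s > k} * v (insert k (S - {j})) else 0)"
proof -
  have "insert k ({..<0} - {j}) \<noteq> {..<0}" if "j < 0" using that assms by auto
  hence "bra0 (psi j (psis k vac)) = 0"
    by (auto simp: bra0_def psi_def psis_def vac_def)
  thus ?thesis using assms by (auto simp: nop_def psi_def psis_def)
qed

lemma distinct_if_sorted_wrt_greater: "sorted_wrt (>) xs \<Longrightarrow> distinct (xs :: int list)"
  by (induction xs) auto

lemma sorted_wrt_greater_filter:
  assumes "sorted_wrt (>) w" "z \<notin> set w"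
  shows "w = filter (\<lambda>y. y > z) w @ filter (\<lambda>y. y < z) (w :: int list)"
  using assms
proof (induction w)
  case (Cons a w)
  show ?case
  proof (cases "a > z")
    case False
    hence "\<forall>y\<in>set (a # w). y < z" using Cons.prems by auto
    thus ?thesis by (auto simp: filter_empty_conv filter_id_conv)
  qed (use Cons in auto)
qed simp

text \<open>Hopping a particle from \<open>x\<close> to \<open>x + l\<close> produces a state whose sorted list of positions is
  obtained by moving \<open>x + l\<close> to the front of the list and from there to its final place; the
  two fermionic signs count exactly these two moves.\<close>
lemma nop_hop:
  fixes c l :: int and xs :: "int list"
  assumes xs: "xs = us @ x # vs" "sorted_wrt (>) xs" "\<And>y. y \<in> set xs \<Longrightarrow> c \<le> y" and "l \<noteq> 0"
    and v: "\<And>ys. sorted_wrt (>) ys \<Longrightarrow> length ys = length xs \<Longrightarrow> (\<And>y. y \<in> set ys \<Longrightarrow> c \<le> y) \<Longrightarrow>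
       v (set ys \<union> {..<c}) = F ys"
    and F: "alternating (length xs) F"
    and low: "\<And>ys y. l < 0 \<Longrightarrow> length ys = length xs \<Longrightarrow> y \<in> set ys \<Longrightarrow> y < c \<Longrightarrow> F ys = 0"
  shows "nop x (x + l) v (set xs \<union> {..<c}) = F (us @ (x + l) # vs)"
proof -
  define z where "z = x + l"
  define S where "S = set xs \<union> {..<c}"
  have zx: "x \<noteq> z" using \<open>l \<noteq> 0\<close> by (simp add: z_def)
  have xS: "x \<in> S" "c \<le> x" using xs by (auto simp: S_def)
  have x_notin: "x \<notin> set us" "x \<notin> set vs" using xs(1,2) by (auto simp: sorted_wrt_append)
  have nop: "nop x z v S = (if z \<notin> S
    then (-1) ^ card {s\<in>S. s > x} * (-1) ^ card {s\<in>S - {x}. s > z} * v (insert z (S - {x})) else 0)"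
    using zx xS by (simp add: nop_offdiag)
  \<comment> \<open>In the first two cases the target site is occupied, so the fermionic side is 0;
    \<open>F\<close> vanishes by \<open>low\<close> in the first case and by antisymmetry in the
    second.\<close>
  consider "z < c" | "z \<in> set us \<union> set vs" | "c \<le> z" "z \<notin> set us \<union> set vs" by linarith
  hence "nop x z v S = F (us @ z # vs)"
  proof cases
    case 1
    moreover from 1 have "l < 0" using xS(2) by (simp add: z_def)
    ultimately have "F (us @ z # vs) = 0" using xs(1) by (intro low[of _ z]) auto
    moreover have "z \<in> S" using 1 by (simp add: S_def)
    ultimately show ?thesis by (simp add: nop)
  next
    case 2
    hence "F (us @ z # vs) = 0" using xs(1) by (intro alternating_not_distinct[OF F]) auto
    moreover have "z \<in> S" using 2 xs(1) by (auto simp: S_def)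
    ultimately show ?thesis by (simp add: nop)
  next
    case 3
    define w where "w = us @ vs"
    define hi where "hi = filter (\<lambda>y. y > z) w"
    define lo where "lo = filter (\<lambda>y. y < z) w"
    have w: "sorted_wrt (>) w" "z \<notin> set w" using xs 3 by (auto simp: w_def sorted_wrt_append)
    have whl: "w = hi @ lo" unfolding hi_def lo_def by (rule sorted_wrt_greater_filter[OF w])
    have distinct: "distinct us" "distinct w"
      using xs(1,2) w(1) by (auto simp: sorted_wrt_append intro: distinct_if_sorted_wrt_greater)
    have "{s\<in>S. s > x} = set us"
      using xs(1,2) xS(2) by (auto simp: S_def sorted_wrt_append)
    hence c1: "card {s\<in>S. s > x} = length us" using distinct(1) by (simp add: distinct_card)
    have "{s\<in>S - {x}. s > z} = set hi"
      using xs(1) 3 x_notin by (auto simp: S_def hi_def w_def)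
    hence c2: "card {s\<in>S - {x}. s > z} = length hi"
      using distinct_card[of hi] distinct(2) by (simp only: hi_def distinct_filter)
    have "S - {x} = set w \<union> {..<c}"
      using xs(1) x_notin xS(2) by (auto simp: S_def w_def)
    also have "set w = set hi \<union> set lo" by (subst whl) simp
    finally have "insert z (S - {x}) = set (hi @ z # lo) \<union> {..<c}" by simp
    also have "v \<dots> = F (hi @ z # lo)"
    proof (rule v)
      show "sorted_wrt (>) (hi @ z # lo)"
        using w(1) unfolding hi_def lo_def by (auto simp: sorted_wrt_append sorted_wrt_filter)
      show "length (hi @ z # lo) = length xs" using arg_cong[OF whl, of length] xs(1) by (simp add: w_def)
      show "c \<le> y" if "y \<in> set (hi @ z # lo)" for y
        using that xs 3 by (auto simp: hi_def lo_def w_def)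
    qed
    also have "\<dots> = (-1) ^ length hi * F (z # w)"
    proof -
      have "length ([] @ hi @ z # lo) = length xs" using arg_cong[OF whl, of length] xs(1) by (simp add: w_def)
      from alternating_move[OF F this] show ?thesis unfolding whl by simp
    qed
    finally have "v (insert z (S - {x})) = (-1) ^ length hi * F (z # w)" .
    moreover have "F (us @ z # vs) = (-1) ^ length us * F (z # w)"
      using alternating_move[OF F, of "[]" us z vs] xs(1) by (simp add: w_def)
    moreover have "z \<notin> S" using 3 xs(1) zx by (auto simp: S_def)
    ultimately show ?thesis unfolding nop c1 c2 by (simp add: mult.assoc)
  qed
  thus ?thesis by (simp add: z_def S_def)
qed

text \<open>By \<open>deep\<close> every target of a particle below \<open>c\<close> is occupied, so
  only the listed particles contribute. Landing below \<open>c\<close> is possible only for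
  \<open>l < 0\<close>, which is the range where \<open>low\<close> is demanded.\<close>

lemma Jcur_eq_hops:
  fixes c l :: int and xs :: "int list"
  assumes xs: "sorted_wrt (>) xs" "\<And>y. y \<in> set xs \<Longrightarrow> c \<le> y" and "l \<noteq> 0"
    and v: "\<And>ys. sorted_wrt (>) ys \<Longrightarrow> length ys = length xs \<Longrightarrow> (\<And>y. y \<in> set ys \<Longrightarrow> c \<le> y) \<Longrightarrow>
       v (set ys \<union> {..<c}) = F ys"
    and F: "alternating (length xs) F"
    and low: "\<And>ys y. l < 0 \<Longrightarrow> length ys = length xs \<Longrightarrow> y \<in> set ys \<Longrightarrow> y < c \<Longrightarrow> F ys = 0"
    and deep: "\<And>j. j < c \<Longrightarrow> j + l \<in> set xs \<union> {..<c}"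
  shows "Jcur l v (set xs \<union> {..<c}) = (\<Sum>a<length xs. F (xs[a := xs ! a + l]))"
proof -
  let ?S = "set xs \<union> {..<c}"
  have "Jcur l v ?S = (\<Sum>j\<in>set xs. nop j (j + l) v ?S)"
    unfolding Jcur_def
  proof (rule sum.mono_neutral_left)
    show "{j. nop j (j + l) v ?S \<noteq> 0} \<subseteq> set xs"
    proof
      fix j assume "j \<in> {j. nop j (j + l) v ?S \<noteq> 0}"
      hence "j \<in> ?S" "j + l \<notin> ?S" using \<open>l \<noteq> 0\<close> by (auto simp: nop_offdiag split: if_splits)
      thus "j \<in> set xs" using deep[of j] by auto
    qed
  qed auto
  also have "\<dots> = (\<Sum>a<length xs. nop (xs ! a) (xs ! a + l) v ?S)"
    using xs(1) by (intro sum.reindex_bij_betw[symmetric] bij_betw_nth distinct_if_sorted_wrt_greater refl)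
  also have "\<dots> = (\<Sum>a<length xs. F (xs[a := xs ! a + l]))"
  proof (rule sum.cong[OF refl])
    fix a assume "a \<in> {..<length xs}"
    hence a: "a < length xs" by simp
    show "nop (xs ! a) (xs ! a + l) v ?S = F (xs[a := xs ! a + l])"
      unfolding upd_conv_take_nth_drop[OF a]
      by (rule nop_hop) (use xs a \<open>l \<noteq> 0\<close> v F low id_take_nth_drop[OF a] in auto)
  qed
  finally show ?thesis .
qed

section \<open>Partitions as decreasing lists of positions\<close>

definition pos :: "int \<Rightarrow> nat \<Rightarrow> nat list \<Rightarrow> int list" where
  "pos n N lam = map (\<lambda>a. n + int (part lam a) - int a) [1..<N+1]"

definition st :: "int \<Rightarrow> nat list \<Rightarrow> int set" where
  "st n lam = {n + int (part lam a) - int a |a. 1 \<le> a}"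

lemma length_pos [simp]: "length (pos n N lam) = N"
  by (simp add: pos_def del: upt_Suc)

lemma nth_pos: "a < N \<Longrightarrow> pos n N lam ! a = n + int (part lam (Suc a)) - int (Suc a)"
  by (simp add: pos_def del: upt_Suc)

lemma pos_Suc: "pos n (Suc N) lam = pos n N lam @ [n + int (part lam (Suc N)) - int (Suc N)]"
  by (simp add: pos_def)

lemma part_eq_0: "length lam < a \<Longrightarrow> part lam a = 0"
  by (simp add: part_def)

lemma part_antimono:
  assumes "is_partition lam" "1 \<le> a" "a \<le> b"
  shows "part lam b \<le> part lam a"
  using assms sorted_wrt_nth_less[of "(\<ge>)" lam "a - 1" "b - 1"]
  by (cases "a = b") (auto simp: part_def is_partition_def)

lemma sorted_pos: "is_partition lam \<Longrightarrow> sorted_wrt (>) (pos n N lam)"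
  unfolding sorted_wrt_iff_nth_less
proof safe
  fix a b assume "is_partition lam" "a < b" "b < length (pos n N lam)"
  thus "pos n N lam ! b < pos n N lam ! a"
    using part_antimono[of lam "Suc a" "Suc b"] by (simp add: nth_pos)
qed

lemma pos_ge: "y \<in> set (pos n N lam) \<Longrightarrow> n - int N \<le> y"
  by (auto simp: pos_def simp del: upt_Suc)

text \<open>Past the last part the positions are consecutive. One state thus has a list for every
  \<open>N \<ge> length lam\<close>, which leaves \<open>N\<close> free to be enlarged.\<close>

lemma st_eq_pos:
  assumes "length lam \<le> N" shows "st n lam = set (pos n N lam) \<union> {..<n - int N}"
proof (intro subset_antisym subsetI)
  fix x assume "x \<in> st n lam"
  then obtain a where a: "1 \<le> a" "x = n + int (part lam a) - int a" by (auto simp: st_def)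
  show "x \<in> set (pos n N lam) \<union> {..<n - int N}"
  proof (cases "a \<le> N")
    case True
    hence "a \<in> set [1..<N+1]" using a by (simp del: upt_Suc)
    thus ?thesis using a unfolding pos_def set_map by blast
  qed (use a assms part_eq_0[of lam a] in auto)
next
  have "set (pos n N lam) \<subseteq> st n lam" by (auto simp: st_def pos_def simp del: upt_Suc)
  moreover fix x assume "x \<in> set (pos n N lam) \<union> {..<n - int N}"
  ultimately consider "x \<in> st n lam" | "x < n - int N" by auto
  thus "x \<in> st n lam"
  proof cases
    assume "x < n - int N"
    hence "x = n + int (part lam (nat (n - x))) - int (nat (n - x))" "1 \<le> nat (n - x)"
      using assms part_eq_0[of lam "nat (n - x)"] by auto
    thus "x \<in> st n lam" unfolding st_def by blast
  qed
qed

text \<open>The lowest position \<open>y\<close> fixes the last part \<open>q\<close> through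
  \<open>y = n + q - (N + 1)\<close>. Partitions contain no zeros, so \<open>q\<close> is appended
  only if it is positive.\<close>

lemma pos_surj:
  assumes "sorted_wrt (>) ys" "\<And>y. y \<in> set ys \<Longrightarrow> n - int (length ys) \<le> y"
  shows "\<exists>nu. is_partition nu \<and> length nu \<le> length ys \<and> pos n (length ys) nu = ys"
  using assms
proof (induction ys rule: rev_induct)
  case Nil
  have "is_partition []" by (simp add: is_partition_def)
  thus ?case by (intro exI[of _ "[]"]) (simp add: pos_def)
next
  case (snoc y ys)
  let ?N = "length ys"
  have gt: "y < y'" if "y' \<in> set ys" for y' using snoc.prems(1) that by (simp add: sorted_wrt_append)
  have y: "n - int (Suc ?N) \<le> y" using snoc.prems(2)[of y] by simp
  have "n - int ?N \<le> y'" if "y' \<in> set ys" for y' using y gt[OF that] by simp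
  then obtain nu where nu: "is_partition nu" "length nu \<le> ?N" "pos n ?N nu = ys"
    using snoc.IH snoc.prems(1) by (auto simp: sorted_wrt_append)
  define q where "q = nat (y - n + int (Suc ?N))"
  have q: "n + int q - int (Suc ?N) = y" using y by (simp add: q_def)
  show ?case
  proof (cases "q = 0")
    case True
    hence "pos n (Suc ?N) nu = ys @ [y]" using nu q by (simp add: pos_Suc part_eq_0)
    thus ?thesis using nu by (intro exI[of _ nu]) simp
  next
    case False
    have ge: "q \<le> part nu (Suc a)" if aN: "a < ?N" for a
    proof -
      obtain M where M: "?N = Suc M" using less_imp_Suc_add[OF aN] by blast
      have "y < pos n ?N nu ! M" unfolding nu(3) using M by (intro gt) simp
      also have "\<dots> = n + int (part nu ?N) - int ?N" using nth_pos[of M ?N n nu] M by simp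
      finally have "q \<le> part nu ?N" using q by simp
      also have "\<dots> \<le> part nu (Suc a)" using that by (intro part_antimono nu) auto
      finally show ?thesis .
    qed
    \<comment> \<open>All earlier parts are at least \<open>q > 0\<close>, so \<open>nu\<close> has
      no implicit zeros and \<open>q\<close> lands at the right index.\<close>
    have len: "length nu = ?N"
    proof (rule antisym[OF nu(2)], rule ccontr)
      assume "\<not> ?N \<le> length nu"
      hence "q \<le> part nu (Suc (length nu))" by (intro ge) simp
      thus False using False by (simp add: part_eq_0)
    qed
    have part: "part (nu @ [q]) a = (if a = Suc ?N then q else part nu a)" for a
      using len by (auto simp: part_def nth_append)
    have "\<forall>x\<in>set nu. q \<le> x"
    proof
      fix x assume "x \<in> set nu"
      then obtain a where "a < length nu" "x = nu ! a" by (metis in_set_conv_nth)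
      thus "q \<le> x" using ge[of a] len by (simp add: part_def)
    qed
    hence "is_partition (nu @ [q])" using nu(1) False by (auto simp: is_partition_def sorted_wrt_append)
    moreover have "pos n ?N (nu @ [q]) = pos n ?N nu" unfolding pos_def by (intro map_cong) (auto simp: part)
    hence "pos n (Suc ?N) (nu @ [q]) = ys @ [y]" using nu(3) q by (simp add: pos_Suc part)
    ultimately show ?thesis using len by (intro exI[of _ "nu @ [q]"]) simp
  qed
qed

lemma Jcur_st:
  assumes mu: "is_partition mu" "length mu \<le> N" and "l \<noteq> 0"
    and N: "l > 0 \<Longrightarrow> int (length mu) + l \<le> int N"
    and v: "\<And>nu. is_partition nu \<Longrightarrow> length nu \<le> N \<Longrightarrow> v (st n nu) = F (pos n N nu)"
    and F: "alternating N F"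
    and low: "\<And>ys y. l < 0 \<Longrightarrow> length ys = N \<Longrightarrow> y \<in> set ys \<Longrightarrow> y < n - int N \<Longrightarrow> F ys = 0"
  shows "Jcur l v (st n mu) = (\<Sum>a<N. F ((pos n N mu)[a := pos n N mu ! a + l]))"
proof -
  have "Jcur l v (set (pos n N mu) \<union> {..<n - int N}) =
     (\<Sum>a<length (pos n N mu). F ((pos n N mu)[a := pos n N mu ! a + l]))"
  proof (rule Jcur_eq_hops)
    fix ys assume ys: "sorted_wrt (>) ys" "length ys = length (pos n N mu)" "\<And>y. y \<in> set ys \<Longrightarrow> n - int N \<le> y"
    then obtain nu where "is_partition nu" "length nu \<le> N" "pos n N nu = ys"
      using pos_surj[of ys n] by auto
    thus "v (set ys \<union> {..<n - int N}) = F ys" using v[of nu] by (simp add: st_eq_pos[of nu N])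
  next
    fix j assume "j < n - int N"
    \<comment> \<open>Sites below \<open>n - length mu\<close> are filled even inside the window;
      this margin of at least \<open>l\<close> sites blocks upward hops out of the sea.\<close>
    hence "j + l < n - int (length mu) \<or> j + l < n - int N" using N by (cases "l > 0") auto
    hence "j + l < n - int (length mu)" using mu(2) by auto
    thus "j + l \<in> set (pos n N mu) \<union> {..<n - int N}"
      using st_eq_pos[of mu "length mu" n] st_eq_pos[OF mu(2), of n] by auto
  qed (use assms sorted_pos pos_ge in auto)
  thus ?thesis using st_eq_pos[OF mu(2)] by simp
qed

section \<open>Skew Schur functions as alternating functions of positions\<close>

lemma ser_prod_list_zero_mono:
  fixes fs :: "'v ser list"
  shows "ser_prod_list fs (\<lambda>_. 0) = (\<Prod>f\<leftarrow>fs. f (\<lambda>_. 0))"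
proof (induction fs)
  case (Cons f fs)
  have "{\<beta> :: 'v mono. \<forall>v. \<beta> v \<le> 0} = {\<lambda>_. 0}" by auto
  hence "ser_prod_list (f # fs) (\<lambda>_. 0) = (\<Sum>\<beta>\<in>{\<lambda>_. 0}. f \<beta> * ser_prod_list fs (\<lambda>v. 0 - \<beta> v))"
    unfolding ser_prod_list_Cons ser_mult_le by (simp only:)
  thus ?case using Cons by simp
qed (simp add: ser_prod_list_Nil ser_one_def)

text \<open>The matrix element of the vertex operator of sign \<open>s\<close> from
  \<open>lam\<close> to \<open>mu\<close>: the sign \<open>+\<close> removes boxes, the sign
  \<open>-\<close> adds them.\<close>

definition skewK :: "nat \<Rightarrow> int \<Rightarrow> nat list \<Rightarrow> nat list \<Rightarrow> (nat \<times> nat) ser" where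
  "skewK i s lam mu = (if s = 1 then skew_schur i lam mu else skew_schur i mu lam)"

text \<open>The positions \<open>ys\<close> that the currents move index the rows, for both signs \<open>s\<close>.\<close>
definition rowdet :: "nat \<Rightarrow> int \<Rightarrow> nat \<Rightarrow> int list \<Rightarrow> int list \<Rightarrow> (nat \<times> nat) ser" where
  "rowdet i s N xs ys = sdet N (\<lambda>a b. hser i (s * (xs ! (b - 1) - ys ! (a - 1))))"

text \<open>A row past both lengths has negative indices left of the diagonal and index 0 on it, so
  it reads \<open>(0, ..., 0, 1)\<close>. A common \<open>N\<close> thus serves many partitions at
  once.\<close>

lemma skew_schur_eq_sdet:
  assumes "fin_mono \<alpha>" "length lam \<le> N" "length mu \<le> N"
  shows "skew_schur i lam mu \<alpha> =
    sdet N (\<lambda>a b. hser i (int (part lam a) - int (part mu b) - int a + int b)) \<alpha>"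
proof -
  have "max (length lam) (length mu) \<le> N" using assms by simp
  thus ?thesis
  proof (induction N rule: nat_induct_at_least)
    case base
    show ?case by (simp add: skew_schur_def sdet_def Let_def)
  next
    case (Suc N)
    show ?case
      using Suc assms(1)
      by (subst sdet_Suc) (auto simp: part_eq_0 hser_neg hser_zero)
  qed
qed

text \<open>The shift by \<open>n\<close> cancels in differences of positions. For
  \<open>s = 1\<close> a transposition is needed, because the Jacobi-Trudi rows belong to
  \<open>lam\<close> while the moved positions belong to \<open>mu\<close>.\<close>

lemma rowdet_pos:
  assumes "fin_mono \<alpha>" "length lam \<le> N" "length mu \<le> N" "s = 1 \<or> s = -1"
  shows "rowdet i s N (pos n N lam) (pos n N mu) \<alpha> = skewK i s lam mu \<alpha>"
proof -
  have p: "pos n N l ! (a - 1) = n + int (part l a) - int a" if "a \<in> {1..N}" for l a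
    using that nth_pos[of "a - 1" N n l] by (cases a) auto
  show ?thesis
  proof (cases "s = 1")
    case True
    have "rowdet i s N (pos n N lam) (pos n N mu) \<alpha> =
       sdet N (\<lambda>a b. hser i (int (part lam b) - int (part mu a) - int b + int a)) \<alpha>"
      unfolding rowdet_def
      by (rule arg_cong[of _ _ "\<lambda>f. f \<alpha>"], rule sdet_cong) (simp only: p True, simp add: algebra_simps)
    also have "\<dots> = skew_schur i lam mu \<alpha>"
      using skew_schur_eq_sdet[OF assms(1-3)]
        sdet_transpose[of N "\<lambda>a b. hser i (int (part lam a) - int (part mu b) - int a + int b)"] by simp
    finally show ?thesis by (simp add: skewK_def True)
  next
    case False
    hence s: "s = -1" using assms(4) by simp
    have "rowdet i s N (pos n N lam) (pos n N mu) \<alpha> =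
       sdet N (\<lambda>a b. hser i (int (part mu a) - int (part lam b) - int a + int b)) \<alpha>"
      unfolding rowdet_def
      by (rule arg_cong[of _ _ "\<lambda>f. f \<alpha>"], rule sdet_cong) (simp only: p s, simp add: algebra_simps)
    thus ?thesis using skew_schur_eq_sdet[OF assms(1,3,2)] by (simp add: skewK_def s)
  qed
qed

lemma alternating_rowdet: "alternating N (\<lambda>ys. rowdet i s N xs ys \<alpha>)"
  unfolding alternating_def
proof (intro allI impI)
  fix us :: "int list" and a b vs assume N: "length (us @ a # b # vs) = N"
  let ?p = "Suc (length us)" and ?q = "Suc (Suc (length us))"
  let ?g = "\<lambda>ys c d. hser i (s * (xs ! (d - 1) - ys ! (c - 1)))"
  have nth: "(us @ a # b # vs) ! (c - 1) = (us @ b # a # vs) ! (transpose ?p ?q c - 1)" if "c \<in> {1..N}" for c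
  proof -
    consider "c \<le> length us" | "c = ?p" | "c = ?q" | k where "c = Suc (Suc (Suc (length us + k)))"
      by (metis le_iff_add not_less_eq_eq add_Suc le_Suc_eq)
    thus ?thesis
      using that by cases (auto simp: nth_append transpose_def)
  qed
  have "rowdet i s N xs (us @ a # b # vs) \<alpha> = sdet N (\<lambda>c. ?g (us @ b # a # vs) (transpose ?p ?q c)) \<alpha>"
    unfolding rowdet_def by (rule arg_cong[of _ _ "\<lambda>f. f \<alpha>"], rule sdet_cong) (simp only: nth)
  also have "\<dots> = - rowdet i s N xs (us @ b # a # vs) \<alpha>"
    unfolding rowdet_def using N by (intro sdet_swap_rows) auto
  finally show "rowdet i s N xs (us @ a # b # vs) \<alpha> = - rowdet i s N xs (us @ b # a # vs) \<alpha>" .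
qed

text \<open>All entries \<open>h(y - x)\<close> of that row have negative index. This matches the
  vanishing of a downward hop into the filled sea.\<close>

lemma rowdet_low:
  assumes "length xs = N" "length ys = N" "y \<in> set ys" "\<And>x. x \<in> set xs \<Longrightarrow> y < x"
  shows "rowdet i (-1) N xs ys \<alpha> = 0"
proof -
  obtain a where "a < N" "ys ! a = y" using assms(2,3) by (metis in_set_conv_nth)
  moreover have "y < xs ! (b - 1)" if "b \<in> {1..N}" for b using that assms by auto
  ultimately show ?thesis unfolding rowdet_def
    by (intro sdet_zero_row[of "Suc a"]) (auto simp: hser_neg)
qed

text \<open>The Euler identity lowers an index \<open>s * (x - y)\<close> by \<open>k\<close>; since
  \<open>s * s = 1\<close>, this is the replacement of \<open>y\<close> by \<open>y + s * k\<close>,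
  a hop of that particle.\<close>

lemma rowdet_euler:
  assumes "fin_mono \<alpha>" "length ys = N" "s = 1 \<or> s = -1"
  shows "of_nat (mdeg \<alpha>) * rowdet i s N xs ys \<alpha> =
    (\<Sum>k\<in>times_in i \<alpha>. \<Sum>a<N. rowdet i s N xs (ys[a := ys ! a + s * int k]) (dec (i, k) \<alpha>))"
proof -
  let ?K = "times_in i \<alpha>"
  let ?g = "\<lambda>a b. hser i (s * (xs ! (b - 1) - ys ! (a - 1)))"
  let ?g' = "\<lambda>k a b. hser i (s * (xs ! (b - 1) - ys ! (a - 1)) - int k)"
  have row: "tmul (i, k) (sdet N (\<lambda>c. if c = Suc a then ?g' k c else ?g c)) \<alpha> =
     rowdet i s N xs (ys[a := ys ! a + s * int k]) (dec (i, k) \<alpha>)" if "k \<in> ?K" "a < N" for k a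
  proof -
    have "s * s = 1" using assms(3) by auto
    hence "s * (x - (y + s * int k)) = s * (x - y) - int k" for x y
      by (simp add: algebra_simps flip: mult.assoc)
    moreover have "ys[a := z] ! (c - 1) = (if c = Suc a then z else ys ! (c - 1))" if "c \<in> {1..N}" for c z
      using that \<open>a < N\<close> assms(2) by (auto simp: nth_list_update)
    ultimately have "sdet N (\<lambda>c. if c = Suc a then ?g' k c else ?g c) = rowdet i s N xs (ys[a := ys ! a + s * int k])"
      unfolding rowdet_def by (intro sdet_cong) auto
    thus ?thesis using \<open>k \<in> ?K\<close> by (simp add: tmul_def times_in_def)
  qed
  have "of_nat (mdeg \<alpha>) * rowdet i s N xs ys \<alpha> =
    (\<Sum>a=1..N. \<Sum>k\<in>?K. tmul (i, k) (sdet N (\<lambda>c. if c = a then ?g' k c else ?g c)) \<alpha>)"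
    unfolding rowdet_def
  proof (rule sdet_euler)
    fix a b \<gamma> assume \<gamma>: "fin_mono \<gamma>" "times_in i \<gamma> \<subseteq> ?K"
    have "of_nat (mdeg \<gamma>) * ?g a b \<gamma> = (\<Sum>k\<in>times_in i \<gamma>. tmul (i, k) (?g' k a b) \<gamma>)"
      unfolding hser_euler[OF \<gamma>(1)] by (intro sum.cong) (auto simp: tmul_def times_in_def)
    also have "\<dots> = (\<Sum>k\<in>?K. tmul (i, k) (?g' k a b) \<gamma>)"
      using \<gamma> finite_times_in[OF assms(1)]
      by (intro sum.mono_neutral_left) (auto simp: tmul_def times_in_def)
    finally show "of_nat (mdeg \<gamma>) * ?g a b \<gamma> = (\<Sum>k\<in>?K. tmul (i, k) (?g' k a b) \<gamma>)" .
  qed (use assms finite_times_in in auto)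
  also have "\<dots> = (\<Sum>a<N. \<Sum>k\<in>?K. rowdet i s N xs (ys[a := ys ! a + s * int k]) (dec (i, k) \<alpha>))"
  proof -
    have "(\<Sum>a=1..N. f a) = (\<Sum>a<N. f (Suc a))" for f :: "nat \<Rightarrow> complex"
      unfolding One_nat_def by (rule sum.atLeast1_atMost_eq)
    thus ?thesis by (simp only:) (intro sum.cong refl row, simp_all)
  qed
  finally show ?thesis by (simp add: sum.swap[of _ ?K])
qed

section \<open>Injectivity of the encoding and constant terms of skew Schur functions\<close>

lemma pos_eq_imp_eq:
  assumes "is_partition lam" "is_partition mu" "length lam \<le> N" "length mu \<le> N" "pos n N lam = pos n N mu"
  shows "lam = mu"
proof -
  have p: "part lam (Suc a) = part mu (Suc a)" for a
  proof (cases "a < N")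
    case True
    thus ?thesis using arg_cong[OF assms(5), of "\<lambda>l. l ! a"] by (simp add: nth_pos)
  qed (use assms in \<open>simp add: part_eq_0\<close>)
  have nz: "part l (Suc a) \<noteq> 0 \<longleftrightarrow> a < length l" if "is_partition l" for l a
    using that by (auto simp: part_def is_partition_def dest: nth_mem)
  have "a < length lam \<longleftrightarrow> a < length mu" for a using p nz assms(1,2) by metis
  hence "length lam = length mu" by (metis linorder_neqE_nat order_less_irrefl)
  moreover have "lam ! a = mu ! a" if "a < length lam" for a
    using p[of a] that \<open>length lam = length mu\<close> by (simp add: part_def)
  ultimately show ?thesis by (intro nth_equalityI)
qed

lemma set_pos_inj:
  assumes "is_partition lam" "is_partition mu" "length lam \<le> N" "length mu \<le> N"
    "set (pos n N lam) = set (pos n N mu)"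
  shows "lam = mu"
proof -
  have "sorted_wrt (<) (rev (pos n N lam))" "sorted_wrt (<) (rev (pos n N mu))"
    using sorted_pos[OF assms(1)] sorted_pos[OF assms(2)] by (simp_all add: sorted_wrt_rev)
  hence "rev (pos n N lam) = rev (pos n N mu)" using assms(5) by (intro strict_sorted_equal) auto
  thus ?thesis using assms(1-4) by (intro pos_eq_imp_eq[of lam mu N n]) auto
qed

text \<open>The constant term of \<open>h_k\<close> is 1 for \<open>k = 0\<close> and 0 otherwise,
  so the matrix only records coincidences of positions. It is the degree 0 case of the comparison
  with the vertex operators.\<close>

lemma skew_schur_zero_mono:
  assumes "is_partition lam" "is_partition mu"
  shows "skew_schur i lam mu (\<lambda>_. 0) = (if lam = mu then 1 else 0)"
proof -
  define N where "N = max (length lam) (length mu)"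
  define x y where "x = (\<lambda>a. int (part lam a) - int a)" and "y = (\<lambda>a. int (part mu a) - int a)"
  let ?t = "\<lambda>p. \<Prod>a=1..N. if x a = y (p a) then 1 else 0 :: complex"
  have "skew_schur i lam mu (\<lambda>_. 0) = (\<Sum>p | p permutes {1..N}. of_int (sign p) * ?t p)"
    unfolding skew_schur_def Let_def N_def[symmetric] ser_prod_list_zero_mono map_map o_def
  proof (intro sum.cong refl arg_cong2[of _ _ _ _ "(*)"])
    fix p
    have "(\<Prod>a\<leftarrow>[1..<N+1]. hser i (int (part lam a) - int (part mu (p a)) - int a + int (p a)) (\<lambda>_. 0)) =
       (\<Prod>a\<in>set [1..<N+1]. hser i (int (part lam a) - int (part mu (p a)) - int a + int (p a)) (\<lambda>_. 0))"
      by (rule prod.distinct_set_conv_list[symmetric]) simp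
    also have "set [1..<N+1] = {1..N}" by auto
    also have "(\<Prod>a=1..N. hser i (int (part lam a) - int (part mu (p a)) - int a + int (p a)) (\<lambda>_. 0)) = ?t p"
      by (intro prod.cong) (auto simp: hser_zero_mono x_def y_def)
    finally show "(\<Prod>a\<leftarrow>[1..<N+1]. hser i (int (part lam a) - int (part mu (p a)) - int a + int (p a)) (\<lambda>_. 0)) = ?t p" .
  qed
  also have "\<dots> = (if lam = mu then 1 else 0)"
  proof -
    have set_pos: "set (pos 0 N l) = (\<lambda>a. int (part l a) - int a) ` {1..N}" for l
      unfolding pos_def by (auto simp del: upt_Suc)
    \<comment> \<open>A nonzero term matches all positions of \<open>lam\<close> with those of
      \<open>mu\<close>; equal position sets give equal partitions, and distinctness of the
      positions then leaves only the identity.\<close>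
    have nz: "lam = mu" "p = id" if p: "p permutes {1..N}" and t: "?t p \<noteq> 0" for p
    proof -
      have xy: "x a = y (p a)" if "a \<in> {1..N}" for a
        using t that unfolding prod_zero_iff[OF finite_atLeastAtMost] by (auto split: if_splits)
      hence "x ` {1..N} = y ` p ` {1..N}" by (auto simp: image_image)
      hence "x ` {1..N} = y ` {1..N}" using permutes_image[OF p] by simp
      thus eq: "lam = mu" using assms
        by (intro set_pos_inj[of lam mu N 0]) (auto simp: N_def set_pos[unfolded N_def] x_def y_def)
      have "inj_on y {1..N}"
      proof (rule linorder_inj_onI)
        fix a b assume "a < b" "a \<in> {1..N}"
        thus "y a \<noteq> y b" using part_antimono[OF assms(2), of a b] by (simp add: y_def)
      qed auto
      moreover have "y a = y (p a)" if "a \<in> {1..N}" for a using xy[OF that] eq by (simp add: x_def y_def)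
      ultimately have "p a = a" if "a \<in> {1..N}" for a
        using that permutes_in_image[OF p] by (metis inj_onD)
      thus "p = id" using permutes_not_in[OF p] by fastforce
    qed
    show ?thesis
    proof (cases "lam = mu")
      case False
      hence "?t p = 0" if "p permutes {1..N}" for p using nz(1) that by blast
      hence "(\<Sum>p | p permutes {1..N}. of_int (sign p) * ?t p) = 0"
        by (intro sum.neutral ballI) (simp only: mem_Collect_eq mult_zero_right)
      thus ?thesis using False by simp
    next
      case True
      hence "?t id = 1" by (simp add: x_def y_def)
      moreover have "(\<Sum>p | p permutes {1..N}. of_int (sign p) * ?t p) = (\<Sum>p\<in>{id}. of_int (sign p) * ?t p)"
        using nz(2) by (intro sum.mono_neutral_right) (auto simp: finite_permutations permutes_id)
      ultimately show ?thesis using True by (simp add: sign_id)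
    qed
  qed
  finally show ?thesis .
qed

lemma ser_prod_list_nonzeroD:
  assumes "fin_mono \<beta>" "ser_prod_list (map f as) \<beta> \<noteq> 0"
    "\<And>a \<gamma>. a \<in> set as \<Longrightarrow> fin_mono \<gamma> \<Longrightarrow> f a \<gamma> \<noteq> 0 \<Longrightarrow> int (wdeg w \<gamma>) = k a \<and> (\<forall>v. \<gamma> v \<noteq> 0 \<longrightarrow> v \<in> A)"
  shows "int (wdeg w \<beta>) = sum_list (map k as) \<and> (\<forall>v. \<beta> v \<noteq> 0 \<longrightarrow> v \<in> A)"
  using assms
proof (induction as arbitrary: \<beta>)
  case Nil
  thus ?case by (auto simp: ser_prod_list_Nil ser_one_def wdeg_def split: if_splits)
next
  case (Cons a as)
  from Cons.prems(2) obtain \<gamma> where \<gamma>: "\<forall>v. \<gamma> v \<le> \<beta> v" "f a \<gamma> \<noteq> 0"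
      "ser_prod_list (map f as) (\<lambda>v. \<beta> v - \<gamma> v) \<noteq> 0"
    unfolding list.map ser_prod_list_Cons ser_mult_le
    by (metis (mono_tags, lifting) mem_Collect_eq mult_eq_0_iff sum.not_neutral_contains_not_neutral)
  have "int (wdeg w \<gamma>) = k a \<and> (\<forall>v. \<gamma> v \<noteq> 0 \<longrightarrow> v \<in> A)"
    using Cons.prems(1,3) \<gamma> by (auto intro: fin_mono_le)
  moreover have "int (wdeg w (\<lambda>v. \<beta> v - \<gamma> v)) = sum_list (map k as) \<and> (\<forall>v. \<beta> v - \<gamma> v \<noteq> 0 \<longrightarrow> v \<in> A)"
    using Cons.prems(3) \<gamma>(3) by (intro Cons.IH fin_mono_diff Cons.prems(1)) auto
  moreover have "wdeg w \<beta> = wdeg w \<gamma> + wdeg w (\<lambda>v. \<beta> v - \<gamma> v)"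
    using \<gamma>(1) by (intro wdeg_diff Cons.prems(1)) simp
  moreover have "\<gamma> v \<noteq> 0 \<or> \<beta> v - \<gamma> v \<noteq> 0" if "\<beta> v \<noteq> 0" for v using that by linarith
  ultimately show ?case by auto
qed

lemma sum_part: "length lam \<le> N \<Longrightarrow> (\<Sum>a=1..N. part lam a) = sum_list lam"
proof -
  assume "length lam \<le> N"
  hence "(\<Sum>a=1..N. part lam a) = (\<Sum>a=1..length lam. part lam a)"
    by (intro sum.mono_neutral_right) (auto simp: part_eq_0)
  also have "\<dots> = (\<Sum>a<length lam. lam ! a)"
    unfolding One_nat_def sum.atLeast1_atMost_eq by (simp add: part_def)
  finally show ?thesis by (simp add: sum_list_sum_nth atLeast0LessThan)
qed

text \<open>The weight of a Leibniz term is the sum of its indices, in which the permutation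
  cancels. This bounds the partitions that can occur and keeps the factors in separate
  variables.\<close>

lemma skew_schur_nonzeroD:
  assumes "fin_mono \<beta>" "skew_schur i lam mu \<beta> \<noteq> 0"
  shows "sum_list lam = sum_list mu + wdeg snd \<beta>" "\<And>v. \<beta> v \<noteq> 0 \<Longrightarrow> fst v = i"
proof -
  define N where "N = max (length lam) (length mu)"
  let ?k = "\<lambda>p a. int (part lam a) - int (part mu (p a)) - int a + int (p a)"
  obtain p where p: "p permutes {1..N}" and nz: "ser_prod_list (map (\<lambda>a. hser i (?k p a)) [1..<N+1]) \<beta> \<noteq> 0"
    using assms(2) unfolding skew_schur_def Let_def N_def[symmetric]
    by (metis (mono_tags, lifting) mem_Collect_eq mult_eq_0_iff sum.not_neutral_contains_not_neutral)
  have "int (wdeg snd \<beta>) = sum_list (map (?k p) [1..<N+1]) \<and> (\<forall>v. \<beta> v \<noteq> 0 \<longrightarrow> v \<in> {v. fst v = i})"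
    using hser_nonzeroD by (intro ser_prod_list_nonzeroD[OF assms(1) nz]) fastforce
  moreover have "sum_list (map (?k p) [1..<N+1]) = (\<Sum>a\<in>set [1..<N+1]. ?k p a)"
    by (rule sum_list_distinct_conv_sum_set) simp
  moreover have "set [1..<N+1] = {1..N}" by auto
  moreover have "(\<Sum>a=1..N. ?k p a) = int (\<Sum>a=1..N. part lam a) - (\<Sum>a=1..N. int (part mu (p a)) - int (p a)) - (\<Sum>a=1..N. int a)"
    by (simp add: sum.distrib sum_subtractf)
  moreover have "(\<Sum>a=1..N. int (part mu (p a)) - int (p a)) = (\<Sum>a=1..N. int (part mu a) - int a)"
    using sum.permute[OF p, of "\<lambda>a. int (part mu a) - int a"] by (simp add: comp_def)
  moreover have "\<dots> = int (\<Sum>a=1..N. part mu a) - (\<Sum>a=1..N. int a)" by (simp add: sum_subtractf)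
  moreover have "(\<Sum>a=1..N. part lam a) = sum_list lam" "(\<Sum>a=1..N. part mu a) = sum_list mu"
    by (auto intro!: sum_part simp: N_def simp del: One_nat_def)
  ultimately have "int (wdeg snd \<beta>) = int (sum_list lam) - int (sum_list mu)"
    and v: "\<forall>v. \<beta> v \<noteq> 0 \<longrightarrow> v \<in> {v. fst v = i}"
    by (simp_all only:) simp
  thus "sum_list lam = sum_list mu + wdeg snd \<beta>" by linarith
  show "fst v = i" if "\<beta> v \<noteq> 0" for v using v that by blast
qed

section \<open>Vertex operators and diagonal operators\<close>

definition mono_at :: "nat \<Rightarrow> (nat \<times> nat) mono \<Rightarrow> (nat \<times> nat) mono" where
  "mono_at i \<alpha> = (\<lambda>v. if fst v = i then \<alpha> v else 0)"

definition mono_off :: "nat \<Rightarrow> (nat \<times> nat) mono \<Rightarrow> (nat \<times> nat) mono" where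
  "mono_off i \<alpha> = (\<lambda>v. if fst v = i then 0 else \<alpha> v)"

lemma fin_mono_at: "fin_mono \<alpha> \<Longrightarrow> fin_mono (mono_at i \<alpha>)"
  by (erule fin_mono_le) (simp add: mono_at_def)

lemma fin_mono_off: "fin_mono \<alpha> \<Longrightarrow> fin_mono (mono_off i \<alpha>)"
  by (erule fin_mono_le) (simp add: mono_off_def)

lemma wdeg_at_off: "fin_mono \<alpha> \<Longrightarrow> wdeg w \<alpha> = wdeg w (mono_at i \<alpha>) + wdeg w (mono_off i \<alpha>)"
proof -
  assume f: "fin_mono \<alpha>"
  have "(\<lambda>v. \<alpha> v - mono_at i \<alpha> v) = mono_off i \<alpha>" by (auto simp: mono_at_def mono_off_def)
  thus ?thesis using wdeg_diff[OF f, of "mono_at i \<alpha>" w] by (simp add: mono_at_def)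
qed

lemma mdeg_at_le: "fin_mono \<alpha> \<Longrightarrow> mdeg (mono_at i \<alpha>) \<le> mdeg \<alpha>"
  using wdeg_at_off[of \<alpha> "\<lambda>_. 1" i] by (simp add: mdeg_eq_wdeg)

lemma mono_at_dec: "mono_at i (dec (i, k) \<alpha>) = dec (i, k) (mono_at i \<alpha>)"
  by (auto simp: mono_at_def dec_def)

lemma mono_off_dec: "mono_off i (dec (i, k) \<alpha>) = mono_off i \<alpha>"
  by (auto simp: mono_off_def dec_def)

lemma times_in_at: "times_in i (mono_at i \<alpha>) = times_in i \<alpha>"
  by (simp add: times_in_def mono_at_def)

lemma mdeg_at_dec:
  "fin_mono \<alpha> \<Longrightarrow> k \<in> times_in i \<alpha> \<Longrightarrow> mdeg (mono_at i \<alpha>) = Suc (mdeg (mono_at i (dec (i, k) \<alpha>)))"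
  using mdeg_dec[of "mono_at i \<alpha>" "(i, k)"]
  by (simp add: mono_at_dec fin_mono_at times_in_def) (simp add: mono_at_def)

lemma Jcur_zero: "Jcur l (\<lambda>_. 0) S = 0"
  by (simp add: Jcur_def nop_def psi_def psis_def)

lemma nop_scale: "nop j k (\<lambda>S. v S / c) S = nop j k v S / c"
  by (simp add: nop_def psi_def psis_def diff_divide_distrib)

lemma Jcur_scale: "c \<noteq> 0 \<Longrightarrow> Jcur l (\<lambda>S. v S / c) S = Jcur l v S / c"
  by (simp add: Jcur_def nop_scale sum_divide_distrib)

text \<open>Independence of the times \<open>t_i\<close>. Under this condition the power of the
  current sum in \<open>gam i\<close> can be read off the monomial.\<close>

definition free_of :: "nat \<Rightarrow> svec \<Rightarrow> bool" where
  "free_of i V \<longleftrightarrow> (\<forall>\<gamma> S k. \<gamma> (i, k) \<noteq> 0 \<longrightarrow> V \<gamma> S = 0)"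

lemma tJ_times_in:
  assumes "fin_mono \<alpha>"
  shows "tJ i s V \<alpha> S = (\<Sum>k\<in>times_in i \<alpha>. Jcur (s * int k) (V (dec (i, k) \<alpha>)) S)"
proof -
  have "tJ i s V \<alpha> S = (\<Sum>k\<in>times_in i \<alpha>. tJ_term i s V \<alpha> S k)"
    unfolding tJ_def using finite_times_in[OF assms]
    by (intro sum.mono_neutral_left) (auto simp: times_in_def tJ_term_def split: if_splits)
  also have "\<dots> = (\<Sum>k\<in>times_in i \<alpha>. Jcur (s * int k) (V (dec (i, k) \<alpha>)) S)"
    by (intro sum.cong) (auto simp: times_in_def tJ_term_def dec_def)
  finally show ?thesis .
qed

text \<open>Each application of \<open>tJ i s\<close> supplies exactly one factor from
  \<open>t_i\<close>, and \<open>V\<close> supplies none.\<close>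

lemma tJ_pow_eq_0:
  assumes "free_of i V" "fin_mono \<alpha>" "mdeg (mono_at i \<alpha>) \<noteq> N"
  shows "(tJ i s ^^ N) V \<alpha> S = 0"
  using assms(2,3)
proof (induction N arbitrary: \<alpha> S)
  case 0
  then obtain v where "mono_at i \<alpha> v \<noteq> 0" using mdeg_0_iff[OF fin_mono_at[OF 0(1)], of i] by auto
  hence "\<alpha> (i, snd v) \<noteq> 0" by (metis mono_at_def prod.collapse)
  thus ?case using assms(1) unfolding free_of_def funpow_0 by blast
next
  case (Suc N)
  have "(tJ i s ^^ N) V (dec (i, k) \<alpha>) = (\<lambda>_. 0)" if "k \<in> times_in i \<alpha>" for k
    using that Suc.prems mdeg_at_dec[of \<alpha> k i] by (intro ext Suc.IH fin_mono_dec) auto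
  thus ?case using Suc.prems by (simp add: tJ_times_in Jcur_zero)
qed

lemma gam_homogeneous:
  assumes "free_of i V" "fin_mono \<alpha>"
  shows "gam i s V \<alpha> S = (tJ i s ^^ mdeg (mono_at i \<alpha>)) V \<alpha> S / fact (mdeg (mono_at i \<alpha>))"
proof -
  have "gam i s V \<alpha> S = (\<Sum>N\<in>{mdeg (mono_at i \<alpha>)}. (tJ i s ^^ N) V \<alpha> S / fact N)"
    unfolding gam_def using assms mdeg_at_le[OF assms(2), of i]
    by (intro sum.mono_neutral_right) (auto simp: tJ_pow_eq_0)
  thus ?thesis by simp
qed

text \<open>In degree \<open>d + 1\<close> only the power \<open>d + 1\<close> survives; its factor
  \<open>1 / fact (d + 1)\<close> times the degree is \<open>1 / fact d\<close>, and the outermost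
  \<open>tJ\<close> is split off.\<close>

lemma gam_euler:
  assumes "free_of i V" "fin_mono \<alpha>" "mdeg (mono_at i \<alpha>) \<noteq> 0"
  shows "of_nat (mdeg (mono_at i \<alpha>)) * gam i s V \<alpha> S =
    (\<Sum>k\<in>times_in i \<alpha>. Jcur (s * int k) (gam i s V (dec (i, k) \<alpha>)) S)"
proof -
  obtain d where d: "mdeg (mono_at i \<alpha>) = Suc d" using assms(3) not0_implies_Suc by blast
  have "of_nat (mdeg (mono_at i \<alpha>)) * gam i s V \<alpha> S = tJ i s ((tJ i s ^^ d) V) \<alpha> S / fact d"
    unfolding gam_homogeneous[OF assms(1,2)] d by (simp del: of_nat_Suc)
  also have "\<dots> = (\<Sum>k\<in>times_in i \<alpha>. Jcur (s * int k) ((tJ i s ^^ d) V (dec (i, k) \<alpha>)) S / fact d)"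
    using assms(2) by (simp add: tJ_times_in sum_divide_distrib)
  also have "\<dots> = (\<Sum>k\<in>times_in i \<alpha>. Jcur (s * int k) (gam i s V (dec (i, k) \<alpha>)) S)"
  proof (rule sum.cong[OF refl])
    fix k assume "k \<in> times_in i \<alpha>"
    hence "mdeg (mono_at i (dec (i, k) \<alpha>)) = d" using mdeg_at_dec[OF assms(2)] d by simp
    hence "gam i s V (dec (i, k) \<alpha>) = (\<lambda>S. (tJ i s ^^ d) V (dec (i, k) \<alpha>) S / fact d)"
      using assms by (simp add: gam_homogeneous fin_mono_dec fun_eq_iff)
    thus "Jcur (s * int k) ((tJ i s ^^ d) V (dec (i, k) \<alpha>)) S / fact d =
       Jcur (s * int k) (gam i s V (dec (i, k) \<alpha>)) S"
      by (simp add: Jcur_scale)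
  qed
  finally show ?thesis .
qed

lemma alternating_sum:
  "(\<And>l. l \<in> P \<Longrightarrow> alternating N (F l)) \<Longrightarrow> alternating N (\<lambda>ys. \<Sum>l\<in>P. F l ys * c l)"
  unfolding alternating_def sum_negf[symmetric] mult_minus_left[symmetric]
  by (intro allI impI sum.cong refl arg_cong2[of _ _ _ _ "(*)"]) blast

text \<open>Induction on the degree in \<open>t_i\<close>: both sides obey the same Euler recursion
  and are the identity in degree 0. Removing a time of set \<open>i\<close> leaves
  \<open>mono_off i \<alpha>\<close> unchanged, so one finite set \<open>P\<close> of input
  partitions serves throughout.\<close>

lemma gam_eq_skew_schur:
  assumes V: "free_of i V" and s: "s = 1 \<or> s = -1"
    and P: "finite P" "\<And>lam. lam \<in> P \<Longrightarrow> is_partition lam"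
    and "fin_mono \<alpha>" "is_partition mu"
    and "\<And>lam. is_partition lam \<Longrightarrow> lam \<notin> P \<Longrightarrow> V (mono_off i \<alpha>) (st n lam) = 0"
  shows "gam i s V \<alpha> (st n mu) =
    (\<Sum>lam\<in>P. skewK i s lam mu (mono_at i \<alpha>) * V (mono_off i \<alpha>) (st n lam))"
  using assms(5-)
proof (induction "mdeg (mono_at i \<alpha>)" arbitrary: \<alpha> mu)
  case 0
  have at: "mono_at i \<alpha> = (\<lambda>_. 0)" using 0 mdeg_0_iff[OF fin_mono_at[OF 0(2)]] by auto
  have off: "mono_off i \<alpha> = \<alpha>" using at unfolding mono_at_def mono_off_def fun_eq_iff by metis
  have "gam i s V \<alpha> (st n mu) = V \<alpha> (st n mu)"
    using gam_homogeneous[OF V 0(2)] 0(1)[symmetric] by simp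
  also have "\<dots> = (\<Sum>lam\<in>P. if lam = mu then V \<alpha> (st n lam) else 0)"
    using P(1) 0 by (auto simp: sum.delta off)
  also have "\<dots> = (\<Sum>lam\<in>P. skewK i s lam mu (mono_at i \<alpha>) * V (mono_off i \<alpha>) (st n lam))"
    using P(2) 0(3) by (intro sum.cong) (auto simp: skewK_def at off skew_schur_zero_mono)
  finally show ?case .
next
  case (Suc d)
  let ?K = "times_in i \<alpha>"
  \<comment> \<open>Covers every \<open>lam\<close> in \<open>P\<close> and \<open>mu\<close>
    together with any hop length; sums stand in for maxima.\<close>
  define N where "N = length mu + \<Sum>?K + (\<Sum>lam\<in>P. length lam)"
  have finK: "finite ?K" using Suc.prems(1) by (rule finite_times_in)
  have NP: "length lam \<le> N" if "lam \<in> P" for lam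
    using member_le_sum[OF that _ P(1), of length] by (simp add: N_def)
  have NK: "length mu + k \<le> N" if "k \<in> ?K" for k
    using member_le_sum[OF that _ finK, of "\<lambda>k. k"] by (simp add: N_def)
  let ?V = "\<lambda>lam. V (mono_off i \<alpha>) (st n lam)"
  let ?R = "\<lambda>\<beta> ys. \<Sum>lam\<in>P. rowdet i s N (pos n N lam) ys \<beta> * ?V lam"
  have step: "Jcur (s * int k) (gam i s V (dec (i, k) \<alpha>)) (st n mu) =
     (\<Sum>a<N. ?R (dec (i, k) (mono_at i \<alpha>)) ((pos n N mu)[a := pos n N mu ! a + s * int k]))"
    if k: "k \<in> ?K" for k
  proof (rule Jcur_st)
    show "is_partition mu" by (fact Suc.prems(2))
    show "length mu \<le> N" by (simp add: N_def)
    show "s * int k \<noteq> 0" using k s by (auto simp: times_in_def)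
    show "int (length mu) + s * int k \<le> int N" if "s * int k > 0"
      using NK[OF k] s that by auto
  next
    fix nu assume nu: "is_partition nu" "length nu \<le> N"
    have "gam i s V (dec (i, k) \<alpha>) (st n nu) =
      (\<Sum>lam\<in>P. skewK i s lam nu (mono_at i (dec (i, k) \<alpha>)) * V (mono_off i (dec (i, k) \<alpha>)) (st n lam))"
      using Suc.hyps(2) mdeg_at_dec[OF Suc.prems(1) k] Suc.prems nu
      by (intro Suc.hyps(1) fin_mono_dec) (auto simp: mono_off_dec)
    also have "\<dots> = ?R (dec (i, k) (mono_at i \<alpha>)) (pos n N nu)"
      using Suc.prems(1) nu NP s
      by (intro sum.cong refl) (simp add: rowdet_pos fin_mono_dec fin_mono_at mono_at_dec mono_off_dec)
    finally show "gam i s V (dec (i, k) \<alpha>) (st n nu) = ?R (dec (i, k) (mono_at i \<alpha>)) (pos n N nu)" .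
  next
    show "alternating N (?R (dec (i, k) (mono_at i \<alpha>)))"
      by (intro alternating_sum alternating_rowdet)
  next
    fix ys y assume y: "s * int k < 0" "length ys = N" "y \<in> set ys" "y < n - int N"
    hence s1: "s = -1" using s by auto
    have "rowdet i s N (pos n N lam) ys (dec (i, k) (mono_at i \<alpha>)) = 0" for lam
      unfolding s1 using y pos_ge[of _ n N lam] by (intro rowdet_low[of _ _ _ y]) fastforce+
    thus "?R (dec (i, k) (mono_at i \<alpha>)) ys = 0" by simp
  qed
  have "of_nat (Suc d) * gam i s V \<alpha> (st n mu) =
    (\<Sum>k\<in>?K. \<Sum>a<N. \<Sum>lam\<in>P. rowdet i s N (pos n N lam) ((pos n N mu)[a := pos n N mu ! a + s * int k])
        (dec (i, k) (mono_at i \<alpha>)) * ?V lam)"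
    using gam_euler[OF V Suc.prems(1), of s "st n mu"] Suc.hyps(2)[symmetric] step by simp
  also have "\<dots> = (\<Sum>lam\<in>P. (\<Sum>k\<in>?K. \<Sum>a<N.
      rowdet i s N (pos n N lam) ((pos n N mu)[a := pos n N mu ! a + s * int k]) (dec (i, k) (mono_at i \<alpha>))) * ?V lam)"
    unfolding sum_distrib_right
    by (rule trans[OF sum.cong[OF refl sum.swap] sum.swap])
  also have "\<dots> = (\<Sum>lam\<in>P. of_nat (Suc d) * rowdet i s N (pos n N lam) (pos n N mu) (mono_at i \<alpha>) * ?V lam)"
    using rowdet_euler[OF fin_mono_at[OF Suc.prems(1)], of "pos n N mu" N s i i] s Suc.hyps(2)
    by (simp add: times_in_at)
  also have "\<dots> = of_nat (Suc d) * (\<Sum>lam\<in>P. skewK i s lam mu (mono_at i \<alpha>) * ?V lam)"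
    unfolding sum_distrib_left mult.assoc using NP Suc.prems s
    by (intro sum.cong refl) (simp add: rowdet_pos fin_mono_at N_def)
  finally show ?case by (simp del: of_nat_Suc)
qed

section \<open>Eigenvalues of the diagonal operators\<close>

lemma psi_psis_diag: "psi j (psis j v) S = (if j \<in> S then v S else 0)"
proof -
  have "{s \<in> S - {j}. j < s} = {s \<in> S. j < s}" by auto
  thus ?thesis by (auto simp: psi_def psis_def insert_absorb)
qed

lemma nop_diag: "nop j j v S = ((if j \<in> S then 1 else 0) - (if j < 0 then 1 else 0)) * v S"
  by (simp add: nop_def psi_psis_diag bra0_def vac_def)

text \<open>As \<open>c \<le> 0\<close>, the state agrees with the vacuum below \<open>c\<close>,
  and normal ordering cancels those sites. The subtracted sum belongs to the vacuum particles from
  \<open>c\<close> on.\<close>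

lemma Hdiag_eq:
  assumes "finite A" "\<And>y. y \<in> A \<Longrightarrow> c \<le> y" "c \<le> 0"
  shows "Hdiag T v (A \<union> {..<c}) = (sum T A - sum T {c..<0}) * v (A \<union> {..<c})"
proof -
  let ?S = "A \<union> {..<c}" and ?U = "A \<union> {c..<0}"
  have "Hdiag T v ?S = (\<Sum>j\<in>?U. T j * nop j j v ?S)"
    unfolding Hdiag_def using assms by (intro sum.mono_neutral_left) (auto simp: nop_diag split: if_splits)
  also have "\<dots> = (\<Sum>j\<in>?U. (if j \<in> A then T j else 0) - (if j \<in> {c..<0} then T j else 0)) * v ?S"
    unfolding sum_distrib_right using assms by (intro sum.cong) (auto simp: nop_diag)
  also have "(\<Sum>j\<in>?U. (if j \<in> A then T j else 0) - (if j \<in> {c..<0} then T j else 0)) = sum T A - sum T {c..<0}"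
  proof -
    have "?U \<inter> A = A" "?U \<inter> {c..<0} = {c..<0}" by auto
    moreover have "finite ?U" using assms(1) by simp
    ultimately show ?thesis unfolding sum_subtractf by (simp only: sum.inter_restrict[symmetric])
  qed
  finally show ?thesis .
qed

lemma Oop_eigen:
  assumes "\<And>v. Hdiag T v S = e * v S"
  shows "Oop T v S = exp e * v S"
proof -
  have "(Hdiag T ^^ N) v S = e ^ N * v S" for N
    by (induction N) (simp_all add: assms)
  hence "Oop T v S = (\<Sum>N. (e ^ N /\<^sub>R fact N) * v S)"
    by (simp add: Oop_def scaleR_conv_of_real divide_inverse mult_ac)
  thus ?thesis by (simp add: exp_def suminf_mult2[OF summable_exp_generic])
qed

text \<open>A common cut-off \<open>c\<close> turns the three cases into one formula, since the
  shared sites cancel.\<close>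

lemma cc_eq:
  assumes "c \<le> 0" "c \<le> n"
  shows "cc T n = exp (sum T {c..<n} - sum T {c..<0})"
proof -
  consider "n = 0" | "0 < n" | "n < 0" by linarith
  thus ?thesis
  proof cases
    case 2
    have "sum T {c..<n} = sum T {c..<0} + sum T {0..<n}"
      using assms 2 by (subst sum.union_disjoint[symmetric]) (auto intro: arg_cong[of _ _ "sum T"])
    moreover have "{0..n-1} = {0..<n}" by auto
    ultimately show ?thesis using 2 by (simp add: cc_def)
  next
    case 3
    have "sum T {c..<0} = sum T {c..<n} + sum T {n..<0}"
      using assms 3 by (subst sum.union_disjoint[symmetric]) (auto intro: arg_cong[of _ _ "sum T"])
    moreover have "{n..-1} = {n..<0}" by auto
    ultimately show ?thesis using 3 by (simp add: cc_def)
  qed (simp add: cc_def)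
qed

text \<open>Row \<open>i\<close> telescopes to \<open>exp (T x - T (n - i))\<close>, where
  \<open>n - i\<close> is the site of the \<open>i\<close>-th particle in the shifted vacuum and
  \<open>x\<close> its site in the state. Empty rows contribute 1. The second sum cancels against
  \<open>cc_eq\<close> at \<open>c = n - N\<close>.\<close>

lemma rr_eq:
  assumes "length lam \<le> N" "is_partition lam"
  shows "rr T lam n = exp (sum T (set (pos n N lam)) - sum T {n - int N..<n})"
proof -
  have row: "(\<Prod>j=1..p. GG T (x + int j)) = exp (T (x + int p) - T x)" for x p
    by (induction p) (auto simp: GG_def exp_add[symmetric] algebra_simps)
  have "cells lam = Sigma {1..length lam} (\<lambda>i. {1..part lam i})" by (auto simp: cells_def)
  hence "rr T lam n = (\<Prod>i=1..length lam. \<Prod>j=1..part lam i. GG T (n + int j - int i))"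
    unfolding rr_def by (simp add: prod.Sigma)
  also have "\<dots> = (\<Prod>i=1..N. \<Prod>j=1..part lam i. GG T (n + int j - int i))"
    using assms by (intro prod.mono_neutral_left) (auto simp: part_eq_0)
  also have "\<dots> = (\<Prod>i=1..N. exp (T (n + int (part lam i) - int i) - T (n - int i)))"
  proof (rule prod.cong[OF refl])
    fix i
    show "(\<Prod>j=1..part lam i. GG T (n + int j - int i)) = exp (T (n + int (part lam i) - int i) - T (n - int i))"
      using row[of "n - int i" "part lam i"] by (simp add: algebra_simps)
  qed
  also have "\<dots> = exp ((\<Sum>i=1..N. T (n + int (part lam i) - int i)) - (\<Sum>i=1..N. T (n - int i)))"
    by (simp add: exp_sum sum_subtractf[symmetric])
  also have "(\<Sum>i=1..N. T (n - int i)) = sum T {n - int N..<n}"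
    by (rule sum.reindex_bij_witness[where i = "\<lambda>j. nat (n - j)" and j = "\<lambda>i. n - int i"]) auto
  also have "(\<Sum>i=1..N. T (n + int (part lam i) - int i)) = (\<Sum>i<N. T (pos n N lam ! i))"
    unfolding One_nat_def sum.atLeast1_atMost_eq by (simp add: nth_pos del: of_nat_Suc)
  also have "\<dots> = sum T (set (pos n N lam))"
    using sorted_pos[OF assms(2)]
    by (intro sum.reindex_bij_betw bij_betw_nth distinct_if_sorted_wrt_greater) auto
  finally show ?thesis .
qed

lemma Oop_st:
  assumes "is_partition lam"
  shows "Oop T v (st n lam) = cc T n * rr T lam n * v (st n lam)"
proof -
  \<comment> \<open>The term \<open>|n|\<close> pushes the window down to
    \<open>n - N \<le> 0\<close>, as the vacuum subtraction requires.\<close>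
  define N where "N = length lam + nat \<bar>n\<bar>"
  have N: "length lam \<le> N" "n - int N \<le> 0" "n - int N \<le> n" by (auto simp: N_def)
  have "Oop T v (st n lam) = exp (sum T (set (pos n N lam)) - sum T {n - int N..<0}) * v (st n lam)"
    unfolding st_eq_pos[OF N(1)] by (intro Oop_eigen Hdiag_eq) (use N pos_ge in auto)
  thus ?thesis using cc_eq[OF N(2,3), of T] rr_eq[OF N(1) assms, of T n]
    by (simp add: exp_diff)
qed

section \<open>The tau-function\<close>

lemma free_of_gam:
  assumes "free_of l V" "l \<noteq> i" shows "free_of l (gam i s V)"
proof -
  have "free_of l (tJ i s W)" if W: "free_of l W" for W
    unfolding free_of_def
  proof (intro allI impI)
    fix \<gamma> :: "(nat \<times> nat) mono" and S k assume "\<gamma> (l, k) \<noteq> 0"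
    hence "W (\<gamma>((i, j) := \<gamma> (i, j) - 1)) = (\<lambda>_. 0)" for j
      using W assms(2) unfolding free_of_def by (intro ext) (metis fst_conv fun_upd_other)
    thus "tJ i s W \<gamma> S = 0" by (simp add: tJ_def tJ_term_def Jcur_zero)
  qed
  hence "free_of l ((tJ i s ^^ N) V)" for N by (induction N) (use assms in auto)
  thus ?thesis unfolding free_of_def gam_def by (metis (mono_tags, lifting) div_0 sum.neutral)
qed

lemma Oop_zero: "Oop T (\<lambda>_. 0) S = 0"
proof -
  have "Hdiag T (\<lambda>_. 0) = (\<lambda>_. 0)" by (simp add: Hdiag_def nop_diag fun_eq_iff)
  hence "(Hdiag T ^^ N) (\<lambda>_. 0) = (\<lambda>_. 0)" for N by (induction N) auto
  thus ?thesis by (simp add: Oop_def)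
qed

lemma free_of_Oser: "free_of l V \<Longrightarrow> free_of l (Oser T V)"
  unfolding free_of_def
proof (intro allI impI)
  fix \<gamma> :: "(nat \<times> nat) mono" and S k
  assume "\<forall>\<gamma> S k. \<gamma> (l, k) \<noteq> 0 \<longrightarrow> V \<gamma> S = 0" "\<gamma> (l, k) \<noteq> 0"
  hence "V \<gamma> = (\<lambda>_. 0)" by blast
  thus "Oser T V \<gamma> S = 0" by (simp add: Oser_def Oop_zero)
qed

lemma free_of_init: "free_of l (init n)"
  unfolding free_of_def init_def by auto

lemma free_of_stage: "i < l \<Longrightarrow> free_of l (stage T \<sigma> n i)"
  by (induction i) (auto intro!: free_of_Oser free_of_gam free_of_init)

text \<open>Each step adds a particle above all others or removes the topmost one, so no signs
  arise.\<close>

lemma ket_eq: "ket n S = (if S = {..<n} then 1 else 0)"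
proof -
  have pos: "ket_pos k S = (if S = {..<int k} then 1 else 0)" for k S
  proof (induction k arbitrary: S)
    case (Suc k)
    have ins: "insert (int k) {..<int k} = {..<int (Suc k)}" by auto
    have iff: "int k \<in> S \<and> S - {int k} = {..<int k} \<longleftrightarrow> S = {..<int (Suc k)}"
      unfolding ins[symmetric] by auto
    have "ket_pos (Suc k) S = (if int k \<in> S \<and> S - {int k} = {..<int k} then (-1) ^ card {s\<in>S. s > int k} else 0)"
      by (simp add: psi_def Suc.IH)
    also have "\<dots> = (if S = {..<int (Suc k)} then 1 else 0)"
    proof (cases "S = {..<int (Suc k)}")
      case True
      hence "{s\<in>S. s > int k} = {}" by auto
      thus ?thesis unfolding iff using True by (simp only: card.empty power_0)
    qed (simp only: iff if_False)
    finally show ?case .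
  qed (simp add: vac_def)
  have neg: "ket_neg k S = (if S = {..<- int k} then 1 else 0)" for k S
  proof (induction k arbitrary: S)
    case (Suc k)
    let ?j = "- int k - 1"
    have del: "{..<- int k} - {?j} = {..<- int (Suc k)}" "?j \<in> {..<- int k}" by auto
    have iff: "?j \<notin> S \<and> insert ?j S = {..<- int k} \<longleftrightarrow> S = {..<- int (Suc k)}"
      unfolding del(1)[symmetric] using del(2) by blast
    have "ket_neg (Suc k) S = (if ?j \<notin> S \<and> insert ?j S = {..<- int k} then (-1) ^ card {s\<in>S. s > ?j} else 0)"
      by (simp add: psis_def Suc.IH)
    also have "\<dots> = (if S = {..<- int (Suc k)} then 1 else 0)"
    proof (cases "S = {..<- int (Suc k)}")
      case True
      hence "{s\<in>S. s > ?j} = {}" by auto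
      thus ?thesis unfolding iff using True by (simp only: card.empty power_0)
    qed (simp only: iff if_False)
    finally show ?case .
  qed (simp add: vac_def)
  show ?thesis by (simp add: ket_def pos neg)
qed

lemma bra_eq: "bra n v = v {..<n}"
proof -
  have none: "card {s. s < a \<and> b < s} = 0" if "a \<le> b + 1" for a b :: int
  proof -
    have "{s. s < a \<and> b < s} = {}" using that by auto
    thus ?thesis by (simp only: card.empty)
  qed
  have pos: "bra_pos k v = v {..<int k}" for k v
  proof (induction k arbitrary: v)
    case (Suc k)
    have "insert (int k) {..<int k} = {..<int (Suc k)}" by auto
    thus ?case by (simp add: Suc.IH psis_def none)
  qed (simp add: bra0_def)
  have neg: "bra_neg k v = v {..<- int k}" for k v
  proof (induction k arbitrary: v)
    case (Suc k)
    have "{..<- int k} - {- int k - 1} = {..<- int (Suc k)}" by auto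
    thus ?case by (simp add: Suc.IH psi_def none)
  qed (simp add: bra0_def)
  show ?thesis by (simp add: bra_def pos neg)
qed

lemma st_Nil: "st n [] = {..<n}"
  using st_eq_pos[of "[]" 0 n] by (simp add: pos_def)

lemma st_eq_vacuum_iff:
  assumes "is_partition lam" shows "st n lam = {..<n} \<longleftrightarrow> lam = []"
proof
  assume eq: "st n lam = {..<n}"
  show "lam = []"
  proof (rule ccontr)
    assume "lam \<noteq> []"
    hence "part lam 1 > 0" using assms by (cases lam) (auto simp: part_def is_partition_def)
    moreover have "n + int (part lam 1) - int 1 \<in> st n lam" unfolding st_def by blast
    ultimately show False using eq by auto
  qed
qed (simp add: st_Nil)

section \<open>Finite truncation of the sums over partitions\<close>

definition partitions_le :: "nat \<Rightarrow> nat list set" where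
  "partitions_le B = {lam. is_partition lam \<and> sum_list lam \<le> B}"

lemma finite_partitions_le: "finite (partitions_le B)"
proof (rule finite_subset)
  show "partitions_le B \<subseteq> {xs. set xs \<subseteq> {..B} \<and> length xs \<le> B}"
  proof
    fix lam assume "lam \<in> partitions_le B"
    hence lam: "\<forall>x\<in>set lam. 0 < x" "sum_list lam \<le> B" by (auto simp: partitions_le_def is_partition_def)
    have "x \<le> B" if "x \<in> set lam" for x using member_le_sum_list[OF that] lam(2) by simp
    moreover have "length lam \<le> sum_list lam" using lam(1) by (induction lam) auto
    ultimately show "lam \<in> {xs. set xs \<subseteq> {..B} \<and> length xs \<le> B}" using lam(2) by auto
  qed
  show "finite \<dots>" by (rule finite_lists_length_le) simp
qed

lemma skewK_sgn: "skewK i (sgn \<sigma> i) lam mu = sig_skew \<sigma> i lam mu"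
  by (simp add: skewK_def sgn_def sig_skew_def)

text \<open>The summand after stage \<open>i\<close> without the factors \<open>cc\<close>;
  \<open>ls\<close> lists the partitions of stages 0 to \<open>i\<close>. Disjointness of the times
  lets coefficients be multiplied as numbers.\<close>

definition stage_term ::
  "(nat \<Rightarrow> bool) \<Rightarrow> (nat \<Rightarrow> int \<Rightarrow> complex) \<Rightarrow> int \<Rightarrow> (nat \<times> nat) mono \<Rightarrow> nat \<Rightarrow> nat list list \<Rightarrow> complex" where
  "stage_term \<sigma> T n \<alpha> i ls = (\<Prod>j\<le>i. rr (T j) (ls ! j) n) * schur 0 (ls ! 0) (mono_at 0 \<alpha>) *
     (\<Prod>j=1..i. sig_skew \<sigma> j (ls ! (j - 1)) (ls ! j) (mono_at j \<alpha>))"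

lemma sum_wdeg_at_le: "fin_mono \<alpha> \<Longrightarrow> (\<Sum>l\<le>j. wdeg w (mono_at l \<alpha>)) \<le> wdeg w \<alpha>"
proof -
  assume f: "fin_mono \<alpha>"
  let ?u = "\<lambda>j v. if fst v \<le> j then \<alpha> v else 0"
  have fu: "fin_mono (?u j)" for j using f by (rule fin_mono_le) simp
  have "(\<Sum>l\<le>j. wdeg w (mono_at l \<alpha>)) = wdeg w (?u j)"
  proof (induction j)
    case 0
    have "mono_at 0 \<alpha> = ?u 0" by (auto simp: mono_at_def)
    thus ?case by simp
  next
    case (Suc j)
    have "mono_at (Suc j) (?u (Suc j)) = mono_at (Suc j) \<alpha>" "mono_off (Suc j) (?u (Suc j)) = ?u j"
      by (auto simp: mono_at_def mono_off_def fun_eq_iff)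
    thus ?case using Suc wdeg_at_off[OF fu, of w "Suc j" "Suc j"] by simp
  qed
  also have "\<dots> \<le> wdeg w \<alpha>" using wdeg_diff[OF f, of "?u j" w] by simp
  finally show ?thesis .
qed

text \<open>From one stage to the next the size drops for \<open>+\<close> and grows for
  \<open>-\<close> by the weight of the monomial in that set of times, so it never exceeds the total
  weight.\<close>

lemma stage_term_bound:
  assumes "fin_mono \<alpha>" "stage_term \<sigma> T n \<alpha> i ls \<noteq> 0" "j \<le> i"
  shows "sum_list (ls ! j) \<le> wdeg snd \<alpha>"
proof -
  have "sum_list (ls ! j) \<le> (\<Sum>l\<le>j. wdeg snd (mono_at l \<alpha>))"
    using assms(3)
  proof (induction j)
    case 0
    have "schur 0 (ls ! 0) (mono_at 0 \<alpha>) \<noteq> 0" using assms(2) by (auto simp: stage_term_def)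
    thus ?case using skew_schur_nonzeroD(1)[OF fin_mono_at[OF assms(1)]] by (fastforce simp: schur_def)
  next
    case (Suc j)
    have "sig_skew \<sigma> (Suc j) (ls ! j) (ls ! Suc j) (mono_at (Suc j) \<alpha>) \<noteq> 0"
      using assms(2) Suc.prems unfolding stage_term_def by force
    hence "sum_list (ls ! Suc j) \<le> sum_list (ls ! j) + wdeg snd (mono_at (Suc j) \<alpha>)"
      using skew_schur_nonzeroD(1)[OF fin_mono_at[OF assms(1)]]
      by (fastforce simp: sig_skew_def split: if_splits)
    thus ?case using Suc by simp
  qed
  thus ?thesis using sum_wdeg_at_le[OF assms(1), of snd j] by linarith
qed

lemma stage_term_off:
  assumes "i < k" shows "stage_term \<sigma> T n (mono_off k \<alpha>) i ls = stage_term \<sigma> T n \<alpha> i ls"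
proof -
  have "mono_at j (mono_off k \<alpha>) = mono_at j \<alpha>" if "j \<le> i" for j
    using that assms by (auto simp: mono_at_def mono_off_def fun_eq_iff)
  thus ?thesis by (simp add: stage_term_def)
qed

lemma stage_term_snoc:
  assumes "length ls = Suc i"
  shows "stage_term \<sigma> T n \<alpha> (Suc i) (ls @ [mu]) = rr (T (Suc i)) mu n *
    sig_skew \<sigma> (Suc i) (last ls) mu (mono_at (Suc i) \<alpha>) * stage_term \<sigma> T n \<alpha> i ls"
proof -
  have 1: "(ls @ [mu]) ! j = ls ! j" if "j \<le> i" for j using that assms by (simp add: nth_append)
  have 2: "(ls @ [mu]) ! Suc i = mu" using assms by (metis nth_append_length)
  have 3: "last ls = ls ! i" using assms by (metis last_conv_nth diff_Suc_1 list.size(3) nat.distinct(1))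
  have "(\<Prod>j\<le>i. rr (T j) ((ls @ [mu]) ! j) n) = (\<Prod>j\<le>i. rr (T j) (ls ! j) n)"
    by (intro prod.cong) (auto simp: 1)
  moreover have "(\<Prod>j=1..i. sig_skew \<sigma> j ((ls @ [mu]) ! (j - 1)) ((ls @ [mu]) ! j) (mono_at j \<alpha>)) =
      (\<Prod>j=1..i. sig_skew \<sigma> j (ls ! (j - 1)) (ls ! j) (mono_at j \<alpha>))"
  proof (rule prod.cong[OF refl])
    fix j assume "j \<in> {1..i}"
    hence "j - 1 \<le> i" "j \<le> i" by auto
    thus "sig_skew \<sigma> j ((ls @ [mu]) ! (j - 1)) ((ls @ [mu]) ! j) (mono_at j \<alpha>) =
      sig_skew \<sigma> j (ls ! (j - 1)) (ls ! j) (mono_at j \<alpha>)" by (simp only: 1)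
  qed
  ultimately show ?thesis
    unfolding stage_term_def using 1[of 0] 1[of i] 2 3 by (simp add: prod.nat_ivl_Suc' mult_ac)
qed

lemma sum_lists_snoc:
  assumes "finite P"
  shows "(\<Sum>x\<in>P. \<Sum>ls | set ls \<subseteq> P \<and> length ls = i. f (ls @ [x])) =
    (\<Sum>ls | set ls \<subseteq> P \<and> length ls = Suc i. f ls)"
  unfolding sum.cartesian_product
proof (rule sum.reindex_bij_witness[where j = "\<lambda>(x, ls). ls @ [x]" and i = "\<lambda>ls. (last ls, butlast ls)"])
  fix ls assume ls: "ls \<in> {ls. set ls \<subseteq> P \<and> length ls = Suc i}"
  hence "ls \<noteq> []" by auto
  thus "(case (last ls, butlast ls) of (x, ls) \<Rightarrow> ls @ [x]) = ls" by simp
  show "(last ls, butlast ls) \<in> P \<times> {ls. set ls \<subseteq> P \<and> length ls = i}"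
    using ls last_in_set[OF \<open>ls \<noteq> []\<close>] in_set_butlastD[of _ ls] by auto
qed auto

text \<open>Inserts a complete set of states at each stage. Since \<open>B\<close> bounds the weight
  of \<open>\<alpha>\<close> and passing to \<open>mono_off\<close> does not raise it, the same
  finite set of partitions works at all stages.\<close>

lemma stage_eq:
  assumes "fin_mono \<alpha>" "\<And>v. \<alpha> v \<noteq> 0 \<Longrightarrow> fst v \<le> i" "wdeg snd \<alpha> \<le> B" "is_partition mu"
  shows "stage T \<sigma> n i \<alpha> (st n mu) = (\<Prod>j\<le>i. cc (T j) n) *
    (\<Sum>ls | set ls \<subseteq> partitions_le B \<and> length ls = i. stage_term \<sigma> T n \<alpha> i (ls @ [mu]))"
  using assms
proof (induction i arbitrary: \<alpha> mu)
  case 0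
  have Nil: "is_partition []" by (simp add: is_partition_def)
  \<comment> \<open>Only \<open>t_0\<close> occurs, so the input is \<open>ket n\<close> itself,
    whose single partition is \<open>[]\<close>.\<close>
  have off: "mono_off 0 \<alpha> = (\<lambda>_. 0)" using 0(2) by (fastforce simp: mono_off_def)
  have "gam 0 (-1) (init n) \<alpha> (st n mu) =
    (\<Sum>lam\<in>{[]}. skewK 0 (-1) lam mu (mono_at 0 \<alpha>) * init n (mono_off 0 \<alpha>) (st n lam))"
    using 0 Nil by (intro gam_eq_skew_schur free_of_init) (auto simp: init_def ket_eq st_eq_vacuum_iff)
  also have "\<dots> = schur 0 mu (mono_at 0 \<alpha>)"
    by (simp add: off init_def ket_eq st_Nil skewK_def schur_def)
  finally have g: "gam 0 (-1) (init n) \<alpha> (st n mu) = schur 0 mu (mono_at 0 \<alpha>)" .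
  have "{ls. set ls \<subseteq> partitions_le B \<and> length ls = 0} = {[]}" by auto
  moreover have "stage_term \<sigma> T n \<alpha> 0 ([] @ [mu]) = rr (T 0) mu n * schur 0 mu (mono_at 0 \<alpha>)"
    by (simp add: stage_term_def)
  ultimately show ?case using g 0(4) by (simp add: Oser_def Oop_st)
next
  case (Suc i)
  let ?P = "partitions_le B" and ?k = "Suc i"
  let ?off = "mono_off ?k \<alpha>"
  let ?L = "\<lambda>i. {ls. set ls \<subseteq> ?P \<and> length ls = i}"
  have foff: "fin_mono ?off" "\<And>v. ?off v \<noteq> 0 \<Longrightarrow> fst v \<le> i" "wdeg snd ?off \<le> B"
  proof -
    show "fin_mono ?off" using Suc.prems(1) by (rule fin_mono_off)
    show "fst v \<le> i" if "?off v \<noteq> 0" for v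
      using that Suc.prems(2)[of v] by (auto simp: mono_off_def split: if_splits)
    show "wdeg snd ?off \<le> B" using Suc.prems(3) wdeg_at_off[OF Suc.prems(1), of snd ?k] by simp
  qed
  have IH: "stage T \<sigma> n i ?off (st n lam) = (\<Prod>j\<le>i. cc (T j) n) *
      (\<Sum>ls\<in>?L i. stage_term \<sigma> T n \<alpha> i (ls @ [lam]))" if "is_partition lam" for lam
    using Suc.IH[OF foff that] by (simp add: stage_term_off)
  have "gam ?k (sgn \<sigma> ?k) (stage T \<sigma> n i) \<alpha> (st n mu) =
    (\<Sum>lam\<in>?P. skewK ?k (sgn \<sigma> ?k) lam mu (mono_at ?k \<alpha>) * stage T \<sigma> n i ?off (st n lam))"
  proof (rule gam_eq_skew_schur)
    fix lam assume lam: "is_partition lam" "lam \<notin> ?P"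
    have "stage_term \<sigma> T n \<alpha> i (ls @ [lam]) = 0" if "ls \<in> ?L i" for ls
    proof (rule ccontr)
      assume "stage_term \<sigma> T n \<alpha> i (ls @ [lam]) \<noteq> 0"
      from stage_term_bound[OF Suc.prems(1) this, of i] have "sum_list lam \<le> B"
        using that Suc.prems(3) by auto
      thus False using lam by (simp add: partitions_le_def)
    qed
    thus "stage T \<sigma> n i ?off (st n lam) = 0" by (simp add: IH[OF lam(1)])
  qed (use Suc.prems finite_partitions_le free_of_stage[of i ?k] in \<open>auto simp: sgn_def partitions_le_def\<close>)
  also have "\<dots> = (\<Prod>j\<le>i. cc (T j) n) * (\<Sum>lam\<in>?P. \<Sum>ls\<in>?L i.
      sig_skew \<sigma> ?k (last (ls @ [lam])) mu (mono_at ?k \<alpha>) * stage_term \<sigma> T n \<alpha> i (ls @ [lam]))"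
    unfolding sum_distrib_left
    by (intro sum.cong refl) (auto simp: IH skewK_sgn sum_distrib_left partitions_le_def mult_ac)
  also have "\<dots> = (\<Prod>j\<le>i. cc (T j) n) * (\<Sum>ls\<in>?L ?k.
      sig_skew \<sigma> ?k (last ls) mu (mono_at ?k \<alpha>) * stage_term \<sigma> T n \<alpha> i ls)"
    by (subst sum_lists_snoc[OF finite_partitions_le]) simp
  finally have g: "gam ?k (sgn \<sigma> ?k) (stage T \<sigma> n i) \<alpha> (st n mu) = (\<Prod>j\<le>i. cc (T j) n) * (\<Sum>ls\<in>?L ?k.
      sig_skew \<sigma> ?k (last ls) mu (mono_at ?k \<alpha>) * stage_term \<sigma> T n \<alpha> i ls)" .
  have "(\<Sum>ls\<in>?L ?k. stage_term \<sigma> T n \<alpha> ?k (ls @ [mu])) = rr (T ?k) mu n * (\<Sum>ls\<in>?L ?k.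
      sig_skew \<sigma> ?k (last ls) mu (mono_at ?k \<alpha>) * stage_term \<sigma> T n \<alpha> i ls)"
    unfolding sum_distrib_left by (intro sum.cong refl) (auto simp: stage_term_snoc)
  thus ?case using g Suc.prems(4) by (simp add: Oser_def Oop_st mult_ac)
qed

text \<open>Only one factorization of the monomial contributes: the part in \<open>t_q\<close> must
  go to \<open>f\<close> and the rest to \<open>g\<close>.\<close>

lemma ser_mult_disjoint:
  assumes "fin_mono \<alpha>"
    and f: "\<And>\<gamma> v. fin_mono \<gamma> \<Longrightarrow> f \<gamma> \<noteq> 0 \<Longrightarrow> \<gamma> v \<noteq> 0 \<Longrightarrow> fst v = q"
    and g: "\<And>\<gamma> v. fin_mono \<gamma> \<Longrightarrow> g \<gamma> \<noteq> 0 \<Longrightarrow> \<gamma> v \<noteq> 0 \<Longrightarrow> fst v \<noteq> q"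
  shows "ser_mult f g \<alpha> = f (mono_at q \<alpha>) * g (mono_off q \<alpha>)"
proof -
  have "ser_mult f g \<alpha> = (\<Sum>\<beta>\<in>{mono_at q \<alpha>}. f \<beta> * g (\<lambda>v. \<alpha> v - \<beta> v))"
    unfolding ser_mult_le
  proof (rule sum.mono_neutral_right)
    show "{mono_at q \<alpha>} \<subseteq> {\<beta>. \<forall>v. \<beta> v \<le> \<alpha> v}" by (auto simp: mono_at_def)
    show "\<forall>\<beta>\<in>{\<beta>. \<forall>v. \<beta> v \<le> \<alpha> v} - {mono_at q \<alpha>}. f \<beta> * g (\<lambda>v. \<alpha> v - \<beta> v) = 0"
    proof (rule ballI, rule ccontr)
      fix \<beta> assume \<beta>: "\<beta> \<in> {\<beta>. \<forall>v. \<beta> v \<le> \<alpha> v} - {mono_at q \<alpha>}" and nz: "f \<beta> * g (\<lambda>v. \<alpha> v - \<beta> v) \<noteq> 0"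
      have "fin_mono \<beta>" using assms(1) by (rule fin_mono_le) (use \<beta> in auto)
      have "\<beta> v = mono_at q \<alpha> v" for v
      proof (cases "fst v = q")
        case True
        hence "\<alpha> v - \<beta> v = 0" using g[OF fin_mono_diff[OF assms(1)]] nz by fastforce
        moreover have "\<beta> v \<le> \<alpha> v" using \<beta> by blast
        ultimately show ?thesis using True by (simp add: mono_at_def)
      next
        case False
        thus ?thesis using f[OF \<open>fin_mono \<beta>\<close>, of v] nz by (auto simp: mono_at_def)
      qed
      thus False using \<beta> by auto
    qed
  qed (use finite_mono_le[OF assms(1)] in simp)
  moreover have "(\<lambda>v. \<alpha> v - mono_at q \<alpha> v) = mono_off q \<alpha>" by (auto simp: mono_at_def mono_off_def)
  ultimately show ?thesis by simp
qed

lemma ser_prod_list_disjoint: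
  assumes "fin_mono \<alpha>" "distinct qs"
    and "\<And>q \<gamma> v. q \<in> set qs \<Longrightarrow> fin_mono \<gamma> \<Longrightarrow> F q \<gamma> \<noteq> 0 \<Longrightarrow> \<gamma> v \<noteq> 0 \<Longrightarrow> fst v = q"
  shows "ser_prod_list (map F qs) \<alpha> =
    (if \<forall>v. \<alpha> v \<noteq> 0 \<longrightarrow> fst v \<in> set qs then \<Prod>q\<in>set qs. F q (mono_at q \<alpha>) else 0)"
  using assms
proof (induction qs arbitrary: \<alpha>)
  case Nil
  thus ?case by (simp add: ser_prod_list_Nil ser_one_def)
next
  case (Cons q qs)
  have q: "q \<notin> set qs" using Cons.prems(2) by simp
  have IH: "ser_prod_list (map F qs) \<gamma> =
    (if \<forall>v. \<gamma> v \<noteq> 0 \<longrightarrow> fst v \<in> set qs then \<Prod>q\<in>set qs. F q (mono_at q \<gamma>) else 0)" if "fin_mono \<gamma>" for \<gamma>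
    by (rule Cons.IH[OF that]) (use Cons.prems in auto)
  have "ser_prod_list (map F (q # qs)) \<alpha> = F q (mono_at q \<alpha>) * ser_prod_list (map F qs) (mono_off q \<alpha>)"
    unfolding list.map ser_prod_list_Cons
  proof (rule ser_mult_disjoint[OF Cons.prems(1)])
    show "fst v = q" if "fin_mono \<gamma>" "F q \<gamma> \<noteq> 0" "\<gamma> v \<noteq> 0" for \<gamma> v
      using that by (intro Cons.prems(3)) auto
    show "fst v \<noteq> q" if "fin_mono \<gamma>" "ser_prod_list (map F qs) \<gamma> \<noteq> 0" "\<gamma> v \<noteq> 0" for \<gamma> v
      using that IH[OF that(1)] q by (metis (no_types, lifting))
  qed
  also have "\<dots> = F q (mono_at q \<alpha>) * (if \<forall>v. \<alpha> v \<noteq> 0 \<longrightarrow> fst v \<in> set (q # qs)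
      then \<Prod>q\<in>set qs. F q (mono_at q \<alpha>) else 0)"
  proof -
    have "mono_at q' (mono_off q \<alpha>) = mono_at q' \<alpha>" if "q' \<in> set qs" for q'
      using that q by (auto simp: mono_at_def mono_off_def fun_eq_iff)
    moreover have "(\<forall>v. mono_off q \<alpha> v \<noteq> 0 \<longrightarrow> fst v \<in> set qs) \<longleftrightarrow> (\<forall>v. \<alpha> v \<noteq> 0 \<longrightarrow> fst v \<in> set (q # qs))"
      by (auto simp: mono_off_def)
    moreover have "(\<Prod>q'\<in>set qs. F q' (mono_at q' (mono_off q \<alpha>))) = (\<Prod>q'\<in>set qs. F q' (mono_at q' \<alpha>))"
      using calculation(1) by (intro prod.cong refl) simp
    ultimately show ?thesis unfolding IH[OF fin_mono_off[OF Cons.prems(1)]] by (simp only:)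
  qed
  also have "\<dots> = (if \<forall>v. \<alpha> v \<noteq> 0 \<longrightarrow> fst v \<in> set (q # qs) then \<Prod>q\<in>set (q # qs). F q (mono_at q \<alpha>) else 0)"
    using q by (simp only: list.set prod.insert finite_set not_False_eq_True mult_zero_right if_distrib[of "(*) _"])
  finally show ?case .
qed

lemma rhs_term_eq:
  assumes "fin_mono \<alpha>" "length ls = Suc m"
  shows "rhs_term m \<sigma> T n ls \<alpha> = (if \<forall>v. \<alpha> v \<noteq> 0 \<longrightarrow> fst v \<le> m + 1
    then schur (m + 1) (last ls) (mono_at (m + 1) \<alpha>) * stage_term \<sigma> T n \<alpha> m ls else 0)"
proof -
  \<comment> \<open>Indexes each factor by the set of times it depends on, so that the indices are
    distinct.\<close>
  define F where "F q = (if q = 0 then schur 0 (ls ! 0) else if q = m + 1 then schur (m + 1) (ls ! m)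
     else sig_skew \<sigma> q (ls ! (q - 1)) (ls ! q))" for q
  let ?qs = "(m + 1) # [1..<m+1] @ [0]"
  have m: "map (\<lambda>i. sig_skew \<sigma> i (ls ! (i - 1)) (ls ! i)) [1..<m+1] = map F [1..<m+1]"
    by (rule map_cong) (auto simp: F_def)
  have "[schur (m + 1) (ls ! m)] @ map (\<lambda>i. sig_skew \<sigma> i (ls ! (i - 1)) (ls ! i)) [1..<m+1] @ [schur 0 (ls ! 0)] = map F ?qs"
    unfolding m by (simp add: F_def)
  moreover have "ser_prod_list (map F ?qs) \<alpha> =
    (if \<forall>v. \<alpha> v \<noteq> 0 \<longrightarrow> fst v \<in> set ?qs then \<Prod>q\<in>set ?qs. F q (mono_at q \<alpha>) else 0)"
  proof (rule ser_prod_list_disjoint[OF assms(1)])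
    fix q \<gamma> v assume "fin_mono \<gamma>" "F q \<gamma> \<noteq> 0" "\<gamma> v \<noteq> 0"
    thus "fst v = q" using skew_schur_nonzeroD(2)[of \<gamma>]
      by (auto simp: F_def schur_def sig_skew_def split: if_splits)
  qed simp
  moreover have qs: "set ?qs = {..m + 1}" by auto
  moreover have "(\<Prod>q\<le>m + 1. F q (mono_at q \<alpha>)) = schur (m + 1) (last ls) (mono_at (m + 1) \<alpha>) *
     (schur 0 (ls ! 0) (mono_at 0 \<alpha>) * (\<Prod>j=1..m. sig_skew \<sigma> j (ls ! (j - 1)) (ls ! j) (mono_at j \<alpha>)))"
  proof -
    have "last ls = ls ! m" using assms(2) by (metis last_conv_nth diff_Suc_1 list.size(3) nat.distinct(1))
    moreover have "(\<Prod>q\<le>m + 1. F q (mono_at q \<alpha>)) = F (m + 1) (mono_at (m + 1) \<alpha>) * (\<Prod>q\<le>m. F q (mono_at q \<alpha>))"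
      by (simp add: mult.commute)
    moreover have "{..m} = insert 0 {1..m}" by auto
    hence "(\<Prod>q\<le>m. F q (mono_at q \<alpha>)) = F 0 (mono_at 0 \<alpha>) * (\<Prod>q=1..m. F q (mono_at q \<alpha>))" by simp
    moreover have "(\<Prod>q=1..m. F q (mono_at q \<alpha>)) = (\<Prod>j=1..m. sig_skew \<sigma> j (ls ! (j - 1)) (ls ! j) (mono_at j \<alpha>))"
      by (rule prod.cong) (auto simp: F_def)
    ultimately show ?thesis by (simp add: F_def)
  qed
  moreover have "(\<forall>v. \<alpha> v \<noteq> 0 \<longrightarrow> fst v \<in> {..m + 1}) \<longleftrightarrow> (\<forall>v. \<alpha> v \<noteq> 0 \<longrightarrow> fst v \<le> m + 1)" by simp
  ultimately show ?thesis unfolding rhs_term_def stage_term_def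
    by (simp only: mult_zero_right mult_zero_left mult_ac if_distrib[of "(*) _"])
qed

theorem theorem3p1:
  fixes m :: nat and n :: int and \<sigma> :: "nat \<Rightarrow> bool"
    and T :: "nat \<Rightarrow> int \<Rightarrow> complex" and \<alpha> :: "(nat \<times> nat) \<Rightarrow> nat"
  assumes "finite {v. \<alpha> v \<noteq> 0}"
  shows "tau m \<sigma> T n \<alpha> =
    (\<Prod>j\<le>m. cc (T j) n) *
    (\<Sum>ls | ls \<in> part_tuples m \<and> rhs_term m \<sigma> T n ls \<alpha> \<noteq> 0. rhs_term m \<sigma> T n ls \<alpha>)"
proof -
  have fin: "fin_mono \<alpha>" using assms by (simp add: fin_mono_def)
  have len: "length ls = Suc m" if "ls \<in> part_tuples m" for ls using that by (simp add: part_tuples_def)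
  show ?thesis
  proof (cases "\<forall>v. \<alpha> v \<noteq> 0 \<longrightarrow> fst v \<le> m + 1")
    case False
    \<comment> \<open>A time outside the sets \<open>0\<close> to \<open>m + 1\<close> divides the
      monomial, and both sides are 0.\<close>
    then obtain l k where lk: "\<alpha> (l, k) \<noteq> 0" "m + 1 < l" by (auto simp: not_le)
    hence "free_of l (gam (m + 1) 1 (stage T \<sigma> n m))" by (intro free_of_gam free_of_stage) auto
    hence "tau m \<sigma> T n \<alpha> = 0" using lk(1) unfolding tau_def bra_eq free_of_def by blast
    moreover have "rhs_term m \<sigma> T n ls \<alpha> = 0" if "ls \<in> part_tuples m" for ls
      using False rhs_term_eq[OF fin len[OF that]] by (simp only: if_False)
    hence "{ls. ls \<in> part_tuples m \<and> rhs_term m \<sigma> T n ls \<alpha> \<noteq> 0} = {}" by blast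
    ultimately show ?thesis by simp
  next
    case True
    define B where "B = wdeg snd \<alpha>"
    let ?P = "partitions_le B" and ?k = "Suc m"
    let ?off = "mono_off ?k \<alpha>"
    let ?L = "\<lambda>i. {ls. set ls \<subseteq> ?P \<and> length ls = i}"
    have foff: "fin_mono ?off" "\<And>v. ?off v \<noteq> 0 \<Longrightarrow> fst v \<le> m" "wdeg snd ?off \<le> B"
    proof -
      show "fin_mono ?off" using fin by (rule fin_mono_off)
      show "fst v \<le> m" if "?off v \<noteq> 0" for v
        using that True[rule_format, of v] by (auto simp: mono_off_def split: if_splits)
      show "wdeg snd ?off \<le> B" using wdeg_at_off[OF fin, of snd ?k] by (simp add: B_def)
    qed
    have st: "stage T \<sigma> n m ?off (st n lam) = (\<Prod>j\<le>m. cc (T j) n) *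
      (\<Sum>ls\<in>?L m. stage_term \<sigma> T n \<alpha> m (ls @ [lam]))" if "is_partition lam" for lam
      using stage_eq[OF foff that] by (simp add: stage_term_off)
    have bound: "sum_list (ls ! j) \<le> B" if "stage_term \<sigma> T n \<alpha> m ls \<noteq> 0" "j \<le> m" for ls j
      using stage_term_bound[OF fin that] by (simp add: B_def)
    \<comment> \<open>\<open>bra n\<close> reads the coefficient at the empty partition, so the last
      vertex operator yields \<open>s_(lam/[]) = s_lam\<close>.\<close>
    have "tau m \<sigma> T n \<alpha> = gam ?k 1 (stage T \<sigma> n m) \<alpha> (st n [])"
      by (simp add: tau_def bra_eq st_Nil)
    also have "\<dots> = (\<Sum>lam\<in>?P. skewK ?k 1 lam [] (mono_at ?k \<alpha>) * stage T \<sigma> n m ?off (st n lam))"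
    proof (rule gam_eq_skew_schur)
      fix lam assume lam: "is_partition lam" "lam \<notin> ?P"
      have "stage_term \<sigma> T n \<alpha> m (ls @ [lam]) = 0" if "ls \<in> ?L m" for ls
      proof (rule ccontr)
        assume "stage_term \<sigma> T n \<alpha> m (ls @ [lam]) \<noteq> 0"
        from bound[OF this, of m] have "sum_list lam \<le> B" using that by auto
        thus False using lam by (simp add: partitions_le_def)
      qed
      thus "stage T \<sigma> n m ?off (st n lam) = 0" by (simp add: st[OF lam(1)])
    qed (use fin finite_partitions_le free_of_stage[of m ?k] in \<open>auto simp: partitions_le_def is_partition_def\<close>)
    also have "\<dots> = (\<Prod>j\<le>m. cc (T j) n) * (\<Sum>lam\<in>?P. \<Sum>ls\<in>?L m.
        rhs_term m \<sigma> T n (ls @ [lam]) \<alpha>)"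
      unfolding sum_distrib_left
    proof (rule sum.cong[OF refl])
      fix lam assume "lam \<in> ?P"
      hence "is_partition lam" by (simp add: partitions_le_def)
      moreover have "rhs_term m \<sigma> T n (ls @ [lam]) \<alpha> =
          schur ?k lam (mono_at ?k \<alpha>) * stage_term \<sigma> T n \<alpha> m (ls @ [lam])" if "ls \<in> ?L m" for ls
        using that True by (subst rhs_term_eq[OF fin]) auto
      ultimately show "skewK ?k 1 lam [] (mono_at ?k \<alpha>) * stage T \<sigma> n m ?off (st n lam) =
          (\<Sum>ls\<in>?L m. (\<Prod>j\<le>m. cc (T j) n) * rhs_term m \<sigma> T n (ls @ [lam]) \<alpha>)"
        by (simp add: st skewK_def schur_def sum_distrib_left mult_ac)
    qed
    also have "(\<Sum>lam\<in>?P. \<Sum>ls\<in>?L m. rhs_term m \<sigma> T n (ls @ [lam]) \<alpha>) = (\<Sum>ls\<in>?L (Suc m). rhs_term m \<sigma> T n ls \<alpha>)"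
      by (rule sum_lists_snoc[OF finite_partitions_le])
    \<comment> \<open>By the weight bound every nonzero term of the infinite family lies among the
      finitely many truncated tuples.\<close>
    also have "\<dots> = (\<Sum>ls | ls \<in> part_tuples m \<and> rhs_term m \<sigma> T n ls \<alpha> \<noteq> 0. rhs_term m \<sigma> T n ls \<alpha>)"
    proof (rule sum.mono_neutral_right)
      show "finite (?L (Suc m))" by (rule finite_lists_length_eq[OF finite_partitions_le])
      show "{ls. ls \<in> part_tuples m \<and> rhs_term m \<sigma> T n ls \<alpha> \<noteq> 0} \<subseteq> ?L (Suc m)"
      proof safe
        fix ls lam assume ls: "ls \<in> part_tuples m" "rhs_term m \<sigma> T n ls \<alpha> \<noteq> 0" "lam \<in> set ls"
        hence "stage_term \<sigma> T n \<alpha> m ls \<noteq> 0" using rhs_term_eq[OF fin len[OF ls(1)]] by (auto split: if_splits)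
        moreover obtain j where "j \<le> m" "lam = ls ! j"
          using ls(3) len[OF ls(1)] by (metis in_set_conv_nth less_Suc_eq_le)
        ultimately have "sum_list lam \<le> B" using bound by blast
        thus "lam \<in> ?P" using ls by (auto simp: partitions_le_def part_tuples_def)
      qed (use len in auto)
      show "\<forall>ls\<in>?L (Suc m) - {ls. ls \<in> part_tuples m \<and> rhs_term m \<sigma> T n ls \<alpha> \<noteq> 0}. rhs_term m \<sigma> T n ls \<alpha> = 0"
        by (auto simp: part_tuples_def partitions_le_def)
    qed
    finally show ?thesis .
  qed
qed

end
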